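(* Let $p\in\{3,4,6\}$ and $N=\lfloor p/2\rfloor\in\{1,2,3\}$. Let $G_p=\langle a,b\mid aba\cdots=bab\cdots\rangle$ (both sides alternating words of length $p$, starting with $a$ and $b$ respectively), let $\Delta=aba\cdots=bab\cdots\in G_p$ be the element given by this word of length $p$, and let $\rho_p:G_p\to \mathrm{SL}_2(\mathbb Z)$ be the homomorphism with $$\rho_p(a)=\begin{pmatrix}1&0\\-N&1\end{pmatrix},\qquad \rho_p(b)=\begin{pmatrix}1&1\\0&1\end{pmatrix}.$$ Then: 1. $\rho_3(\Delta)=\begin{pmatrix}0&1\\-1&0\end{pmatrix}$, $\rho_4(\Delta)=\begin{pmatrix}-1&0\\0&-1\end{pmatrix}$, $\rho_6(\Delta)=\begin{pmatrix}1&0\\0&1\end{pmatrix}$. In particular the images of $\rho_3$ and $\rho_4$ contain $-\mathrm{id}$, but the image of $\rho_6$ does not. 2. The image of $\rho_p$ is equal to the congruence subgroup $\Gamma_1(N)=\{\begin{pmatrix}a&b\\c&d\end{pmatrix}\in \mathrm{SL}_2(\mathbb Z): a\equiv d\equiv1,\ c\equiv0 \bmod N\}$. 3. The kernel of $\rho_p$ is an infinite cyclic group generated by $(ab)^{k_p}$, where $k_3=6$, $k_4=4$, $k_6=3$. 4. Thus there is a short exact sequence $1\to\mathbb Z\to G_p\to\Gamma_1(N)\to1$ exhibiting $G_p$ as a central extension of $\Gamma_1(N)$.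
   Context: $p=3,4,6$ correspond to types $\mathrm A_2,\mathrm B_2,\mathrm G_2$; $G_p$ is the Artin group of type $\mathrm I_2(p)$. (In the source, $G_p$ is the fundamental group of the discriminant complement of a two-parameter family of elliptic curves, and $\rho_p$ is its monodromy representation on the first homology of the compactified elliptic curve in a suitable basis; this is not needed for the statement.) *)

theory Defs
  imports
    "HOL-Analysis.Determinants"
    "HOL-Algebra.Elementary_Groups"
    "HOL-Number_Theory.Cong"
begin

section \<open>Groups given by generators and relations\<close>

text \<open>A letter \<open>(x, True)\<close> stands for the generator \<open>x\<close>, and \<open>(x, False)\<close> for its formal inverse.\<close>

type_synonym 'g word = "('g \<times> bool) list"

definition positive_word :: "'g list \<Rightarrow> 'g word" where
  "positive_word xs = map (\<lambda>x. (x, True)) xs"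

text \<open>The congruence on words generated by free cancellation and by the relations
  \<open>u = v\<close> with \<open>(u, v) \<in> R\<close>.\<close>

inductive word_eq :: "('g word \<times> 'g word) set \<Rightarrow> 'g word \<Rightarrow> 'g word \<Rightarrow> bool"
  for R :: "('g word \<times> 'g word) set" where
  refl: "word_eq R u u"
| sym: "word_eq R u v \<Longrightarrow> word_eq R v u"
| trans: "word_eq R u v \<Longrightarrow> word_eq R v w \<Longrightarrow> word_eq R u w"
| append: "word_eq R u u' \<Longrightarrow> word_eq R v v' \<Longrightarrow> word_eq R (u @ v) (u' @ v')"
| cancel: "word_eq R [(x, s), (x, \<not> s)] []"
| relation: "(u, v) \<in> R \<Longrightarrow> word_eq R u v"

definition word_class :: "('g word \<times> 'g word) set \<Rightarrow> 'g word \<Rightarrow> 'g word set" where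
  "word_class R u = {v. word_eq R u v}"

definition presented_group :: "('g word \<times> 'g word) set \<Rightarrow> 'g word set monoid" where
  "presented_group R =
    \<lparr>carrier = range (word_class R),
     monoid.mult = (\<lambda>X Y. \<Union>u\<in>X. \<Union>v\<in>Y. word_class R (u @ v)),
     one = word_class R []\<rparr>"

lemma word_class_eq_iff: "word_class R u = word_class R v \<longleftrightarrow> word_eq R u v"
  unfolding word_class_def set_eq_iff mem_Collect_eq
  by (metis word_eq.refl word_eq.sym word_eq.trans)

lemma word_class_self: "u \<in> word_class R u"
  by (simp add: word_class_def word_eq.refl)

lemma carrier_presented_group [simp]: "carrier (presented_group R) = range (word_class R)"
  by (simp add: presented_group_def)

lemma one_presented_group [simp]: "\<one>\<^bsub>presented_group R\<^esub> = word_class R []"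
  by (simp add: presented_group_def)

lemma mult_presented_group [simp]:
  "word_class R u \<otimes>\<^bsub>presented_group R\<^esub> word_class R v = word_class R (u @ v)"
proof -
  have "word_class R (u' @ v') = word_class R (u @ v)"
    if "u' \<in> word_class R u" "v' \<in> word_class R v" for u' v'
    using that unfolding word_class_eq_iff
    by (metis word_class_def mem_Collect_eq word_eq.append word_eq.sym)
  then show ?thesis
    using word_class_self[of u R] word_class_self[of v R]
    unfolding presented_group_def monoid.simps by blast
qed

lemma word_eq_inverse:
  "word_eq R (rev (map (\<lambda>(x, s). (x, \<not> s)) u) @ u) []"
proof (induction u)
  case Nil
  then show ?case by (simp add: word_eq.refl)
next
  case (Cons a u)
  let ?i = "\<lambda>u. rev (map (\<lambda>(x, s). (x, \<not> s)) u)"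
  obtain x s where a: "a = (x, s)" by (cases a)
  have "word_eq R [(x, \<not> s), (x, s)] []"
    using word_eq.cancel[of R x "\<not> s"] by simp
  then have "word_eq R (?i u @ ([(x, \<not> s), (x, s)] @ u)) (?i u @ ([] @ u))"
    by (intro word_eq.append word_eq.refl)
  then have "word_eq R (?i (a # u) @ a # u) (?i u @ u)"
    by (simp add: a)
  then show ?case using Cons.IH by (rule word_eq.trans)
qed

lemma group_presented_group: "group (presented_group R)"
proof (rule groupI)
  fix X assume "X \<in> carrier (presented_group R)"
  then obtain u where "X = word_class R u" by auto
  then show "\<exists>Y\<in>carrier (presented_group R). Y \<otimes>\<^bsub>presented_group R\<^esub> X = \<one>\<^bsub>presented_group R\<^esub>"
    using word_eq_inverse[of R u] by (auto simp: word_class_eq_iff)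
qed auto

fun eval_word :: "('a, 'm) monoid_scheme \<Rightarrow> ('g \<Rightarrow> 'a) \<Rightarrow> 'g word \<Rightarrow> 'a" where
  "eval_word H f [] = \<one>\<^bsub>H\<^esub>"
| "eval_word H f ((x, s) # u) = (if s then f x else inv\<^bsub>H\<^esub> f x) \<otimes>\<^bsub>H\<^esub> eval_word H f u"

lemma (in group) eval_word_closed:
  "(\<And>x. f x \<in> carrier G) \<Longrightarrow> eval_word G f u \<in> carrier G"
  by (induction u) auto

lemma (in group) eval_word_append:
  "(\<And>x. f x \<in> carrier G) \<Longrightarrow> eval_word G f (u @ v) = eval_word G f u \<otimes> eval_word G f v"
  by (induction u) (auto simp: eval_word_closed m_assoc)

lemma (in group) eval_word_cong:
  assumes "word_eq R u v" "\<And>x. f x \<in> carrier G"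
    and "\<And>u v. (u, v) \<in> R \<Longrightarrow> eval_word G f u = eval_word G f v"
  shows "eval_word G f u = eval_word G f v"
  using assms(1)
  by (induction rule: word_eq.induct) (auto simp: eval_word_append assms(2,3))

text \<open>The universal property of a presentation.\<close>

theorem presented_group_hom_exists:
  fixes H (structure)
  assumes "group H" and f: "\<And>x. f x \<in> carrier H"
    and rel: "\<And>u v. (u, v) \<in> R \<Longrightarrow> eval_word H f u = eval_word H f v"
  shows "\<exists>h \<in> hom (presented_group R) H. \<forall>x. h (word_class R [(x, True)]) = f x"
proof -
  interpret group H by fact
  define h where "h = (\<lambda>X. eval_word H f (SOME u. u \<in> X))"
  have h: "h (word_class R u) = eval_word H f u" for u
  proof -
    have "(SOME v. v \<in> word_class R u) \<in> word_class R u"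
      by (rule someI) (rule word_class_self)
    then have "word_eq R u (SOME v. v \<in> word_class R u)"
      by (simp add: word_class_def)
    then show ?thesis
      unfolding h_def by (metis eval_word_cong f rel)
  qed
  have "h \<in> hom (presented_group R) H"
    by (auto simp: hom_def h eval_word_append eval_word_closed f)
  moreover have "\<forall>x. h (word_class R [(x, True)]) = f x"
    by (simp add: h f)
  ultimately show ?thesis by blast
qed

theorem presented_group_hom_unique:
  fixes H (structure)
  assumes "group H"
    and h: "h \<in> hom (presented_group R) H" and k: "k \<in> hom (presented_group R) H"
    and eq: "\<And>x. h (word_class R [(x, True)]) = k (word_class R [(x, True)])"
    and X: "X \<in> carrier (presented_group R)"
  shows "h X = k X"
proof -
  interpret P: group "presented_group R" by (rule group_presented_group)
  interpret h: group_hom "presented_group R" H h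
    by (simp add: group_hom.intro group_hom_axioms.intro assms group_presented_group)
  interpret k: group_hom "presented_group R" H k
    by (simp add: group_hom.intro group_hom_axioms.intro assms group_presented_group)
  have letter: "h (word_class R [(x, s)]) = k (word_class R [(x, s)])" for x s
  proof (cases s)
    case False
    have "word_class R [(x, False)] \<otimes>\<^bsub>presented_group R\<^esub> word_class R [(x, True)]
        = \<one>\<^bsub>presented_group R\<^esub>"
      using word_eq.cancel[of R x False] by (simp add: word_class_eq_iff)
    then have "word_class R [(x, False)] = inv\<^bsub>presented_group R\<^esub> word_class R [(x, True)]"
      using P.inv_equality[of "word_class R [(x, False)]" "word_class R [(x, True)]"] by simp
    then show ?thesis using False eq[of x] by simp
  qed (simp add: eq)
  have "h (word_class R u) = k (word_class R u)" for u
  proof (induction u)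
    case Nil
    then show ?case using h.hom_one k.hom_one by simp
  next
    case (Cons a u)
    have "word_class R (a # u) = word_class R [a] \<otimes>\<^bsub>presented_group R\<^esub> word_class R u"
      by simp
    then show ?case using Cons letter[of "fst a" "snd a"]
      by (simp only: h.hom_mult k.hom_mult carrier_presented_group rangeI prod.collapse)
  qed
  with X show ?thesis by auto
qed


section \<open>Artin groups of type $\mathrm I_2(p)$\<close>

datatype artin_gen = Gen_a | Gen_b

fun alternating :: "nat \<Rightarrow> 'g \<Rightarrow> 'g \<Rightarrow> 'g list" where
  "alternating 0 x y = []"
| "alternating (Suc n) x y = x # alternating n y x"

definition artin_relations :: "nat \<Rightarrow> (artin_gen word \<times> artin_gen word) set" where
  "artin_relations p =
    {(positive_word (alternating p Gen_a Gen_b), positive_word (alternating p Gen_b Gen_a))}"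

definition artin_group :: "nat \<Rightarrow> artin_gen word set monoid" where
  "artin_group p = presented_group (artin_relations p)"

definition artin_a :: "nat \<Rightarrow> artin_gen word set" where
  "artin_a p = word_class (artin_relations p) [(Gen_a, True)]"

definition artin_b :: "nat \<Rightarrow> artin_gen word set" where
  "artin_b p = word_class (artin_relations p) [(Gen_b, True)]"

definition artin_Delta :: "nat \<Rightarrow> artin_gen word set" where
  "artin_Delta p = word_class (artin_relations p) (positive_word (alternating p Gen_a Gen_b))"

lemma artin_Delta_alt:
  "artin_Delta p = word_class (artin_relations p) (positive_word (alternating p Gen_b Gen_a))"
  unfolding artin_Delta_def word_class_eq_iff
  by (rule word_eq.relation) (simp add: artin_relations_def)


section \<open>The groups $\mathrm{SL}_2(\mathbb Z)$ and $\Gamma_1(N)$\<close>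

abbreviation mat2 :: "int \<Rightarrow> int \<Rightarrow> int \<Rightarrow> int \<Rightarrow> int^2^2" where
  "mat2 a b c d \<equiv> vector [vector [a, b], vector [c, d]]"

definition SL2Z :: "(int^2^2) monoid" where
  "SL2Z = \<lparr>carrier = {A. det A = 1}, monoid.mult = (**), one = mat 1\<rparr>"

definition Gamma1 :: "nat \<Rightarrow> (int^2^2) set" where
  "Gamma1 N = {A \<in> carrier SL2Z.
     [A $ 1 $ 1 = 1] (mod int N) \<and> [A $ 2 $ 2 = 1] (mod int N) \<and> [A $ 2 $ 1 = 0] (mod int N)}"

lemma group_SL2Z: "group SL2Z"
proof (rule groupI)
  fix A assume A: "A \<in> carrier SL2Z"
  define B where "B = mat2 (A $ 2 $ 2) (- A $ 1 $ 2) (- A $ 2 $ 1) (A $ 1 $ 1)"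
  have "det B = 1" "B ** A = mat 1"
    using A by (auto simp: SL2Z_def B_def det_2 vec_eq_iff forall_2 matrix_matrix_mult_def
        sum_2 mat_def algebra_simps)
  then show "\<exists>B\<in>carrier SL2Z. B \<otimes>\<^bsub>SL2Z\<^esub> A = \<one>\<^bsub>SL2Z\<^esub>"
    by (auto simp: SL2Z_def)
qed (auto simp: SL2Z_def det_mul matrix_mul_assoc)

text \<open>Such a \<open>\<rho>\<close> is unique on the carrier of \<open>artin_group p\<close> (cf. \<open>presented_group_hom_unique\<close>),
  but arbitrary outside it.\<close>

definition is_rho :: "nat \<Rightarrow> (artin_gen word set \<Rightarrow> int^2^2) \<Rightarrow> bool" where
  "is_rho p \<rho> \<longleftrightarrow>
     \<rho> \<in> hom (artin_group p) SL2Z \<and>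
     \<rho> (artin_a p) = mat2 1 0 (- int (p div 2)) 1 \<and>
     \<rho> (artin_b p) = mat2 1 1 0 1"


section \<open>Central extensions\<close>

text \<open>\<open>1 \<rightarrow> A \<rightarrow> E \<rightarrow> Q \<rightarrow> 1\<close> with maps \<open>\<iota>\<close> and \<open>\<pi>\<close>. The library's \<open>short_exact_sequence\<close> is not
  usable here, since it requires all groups in the sequence to have the same element type.\<close>

definition short_exact ::
  "'a monoid \<Rightarrow> 'e monoid \<Rightarrow> 'q monoid \<Rightarrow> ('a \<Rightarrow> 'e) \<Rightarrow> ('e \<Rightarrow> 'q) \<Rightarrow> bool" where
  "short_exact A E Q \<iota> \<pi> \<longleftrightarrow>
     group A \<and> group E \<and> group Q \<and> \<iota> \<in> mon A E \<and> \<pi> \<in> epi E Q \<and>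
     \<iota> ` carrier A = kernel E Q \<pi>"

definition central_extension ::
  "'a monoid \<Rightarrow> 'e monoid \<Rightarrow> 'q monoid \<Rightarrow> ('a \<Rightarrow> 'e) \<Rightarrow> ('e \<Rightarrow> 'q) \<Rightarrow> bool" where
  "central_extension A E Q \<iota> \<pi> \<longleftrightarrow>
     short_exact A E Q \<iota> \<pi> \<and>
     (\<forall>x \<in> carrier A. \<forall>g \<in> carrier E. \<iota> x \<otimes>\<^bsub>E\<^esub> g = g \<otimes>\<^bsub>E\<^esub> \<iota> x)"

end

(*
  Let G_p act on the right on integer row vectors through rho_p, and let H be the subgroup generated
  by b and by a central power z of ab with rho_p(z) = 1 or -1; it fixes (0, 1) up to sign. A variant of
  the Euclidean algorithm assigns to every vector (N c, d) in the orbit a right coset F(c, d) of H,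
  with F(0, 1) = H, and the relations of G_p are just what is needed for F to be equivariant under a
  and b. Hence an element acting trivially lies in H, and there one reads off that it is a power of
  (ab)^k. The algorithm also reaches every admissible bottom row, which gives the image. The kernel is
  infinite because the word length defines a homomorphism G_p -> Z.
*)

theory Submission
  imports Defs
begin

text \<open>A vector is reached by many words, and it is not yet known which words act trivially, so
  two choices can be compared only through relations of \<open>G_p\<close>. The algorithm is
  therefore run in generators for which these relations become torsion modulo \<open>z\<close>. For
  p = 2 m, \<open>a\<close> and \<open>x = a b\<close> generate, subject to \<open>x^m = z\<close>
  being central, so the quotient by \<open>z\<close> is the free product of Z and Z/m. For p = 3,
  \<open>x\<close> and \<open>y = a b a\<close> generate, with \<open>x^3 = y^2 = z\<close>, and the
  quotient is the free product of Z/3 and Z/2. On slopes c/d the factors move intervals into one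
  another as in a ping-pong argument: the interval containing the slope decides the next step, and a
  factor of finite order causes no ambiguity because H absorbs \<open>z\<close>. Signs are ignored
  in the algorithm, as \<open>z\<close> acts by -1 for N = 1, 2; for N = 3 it acts trivially, and
  the sign is recovered by following an actual word.\<close>

lemma mat2_nth [simp]:
  "mat2 a b c d $ 1 $ 1 = a" "mat2 a b c d $ 1 $ 2 = b"
  "mat2 a b c d $ 2 $ 1 = c" "mat2 a b c d $ 2 $ 2 = d"
  by simp_all

lemma mat2_eq_iff: "A = B \<longleftrightarrow> A $ 1 $ 1 = B $ 1 $ 1 \<and> A $ 1 $ 2 = B $ 1 $ 2
    \<and> A $ 2 $ 1 = B $ 2 $ 1 \<and> A $ 2 $ 2 = B $ 2 $ 2" for A B :: "'a^2^2"
  by (auto simp: vec_eq_iff forall_2)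

lemma mat_1_eq_mat2: "mat 1 = mat2 1 0 0 1"
  by (simp add: mat2_eq_iff mat_def)

lemma uminus_mat2: "- mat2 a b c d = mat2 (- a) (- b) (- c) (- d)"
  by (simp add: mat2_eq_iff)

lemma matrix_mult_nth_2: "(A ** B) $ i $ j = A $ i $ 1 * B $ 1 $ j + A $ i $ 2 * B $ 2 $ j"
  for A B :: "int^2^2"
  by (simp add: matrix_matrix_mult_def sum_2)

lemma mat2_mult: "mat2 a b c d ** mat2 a' b' c' d'
    = mat2 (a * a' + b * c') (a * b' + b * d') (c * a' + d * c') (c * b' + d * d')"
  by (simp add: mat2_eq_iff matrix_mult_nth_2)

lemma SL2Z_simps [simp]:
  "A \<in> carrier SL2Z \<longleftrightarrow> A $ 1 $ 1 * A $ 2 $ 2 - A $ 1 $ 2 * A $ 2 $ 1 = 1"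
  "A \<otimes>\<^bsub>SL2Z\<^esub> B = A ** B" "\<one>\<^bsub>SL2Z\<^esub> = mat2 1 0 0 1"
  by (simp_all add: SL2Z_def det_2 mat_1_eq_mat2)

lemma inv_SL2Z:
  assumes "A \<in> carrier SL2Z"
  shows "inv\<^bsub>SL2Z\<^esub> A = mat2 (A $ 2 $ 2) (- A $ 1 $ 2) (- A $ 2 $ 1) (A $ 1 $ 1)"
  by (rule group.inv_equality[OF group_SL2Z])
    (use assms in \<open>auto simp: mat2_eq_iff matrix_mult_nth_2 algebra_simps\<close>)

lemma coprime_matrix_row_2:
  assumes "A \<in> carrier SL2Z"
  shows "coprime (A $ 2 $ 1) (A $ 2 $ 2)"
proof (rule coprimeI)
  fix k assume "k dvd A $ 2 $ 1" "k dvd A $ 2 $ 2"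
  then have "k dvd A $ 1 $ 1 * A $ 2 $ 2 - A $ 1 $ 2 * A $ 2 $ 1" by simp
  then show "is_unit k" using assms by simp
qed

text \<open>Letters are appended on the right because row vectors carry a right action: equivariance
  tells what one further generator does, but not what a product of two arbitrary elements
  does.\<close>

lemma (in group) generate_induct_right [consumes 2, case_names one mult mult_inv]:
  assumes "g \<in> generate G S" "S \<subseteq> carrier G"
    and one: "P \<one>"
    and mult: "\<And>g s. g \<in> carrier G \<Longrightarrow> P g \<Longrightarrow> s \<in> S \<Longrightarrow> P (g \<otimes> s)"
    and mult_inv: "\<And>g s. g \<in> carrier G \<Longrightarrow> P g \<Longrightarrow> s \<in> S \<Longrightarrow> P (g \<otimes> inv s)"
  shows "P g"
proof -
  \<comment> \<open>Strengthened for the induction: the elements \<open>h\<close> whose right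
    multiplication preserves \<open>P\<close> are closed under products.\<close>
  have "h \<in> carrier G \<and> (\<forall>g\<in>carrier G. P g \<longrightarrow> P (g \<otimes> h))" if "h \<in> generate G S" for h
    using that
  proof induction
    case (eng h1 h2)
    then show ?case by (metis m_assoc m_closed)
  qed (use assms in auto)
  from this[OF assms(1)] one show ?thesis by (metis l_one one_closed)
qed

text \<open>The centraliser of \<open>t\<close> is closed under products and inverses. This yields
  the centrality of \<open>(a b)^m\<close> in the Artin groups and, with \<open>g\<close> a power of
  \<open>z\<close>, that of the powers of \<open>z\<close>.\<close>

lemma (in group) commute_generate:
  assumes "g \<in> generate G S" "S \<subseteq> carrier G" "t \<in> carrier G"
    and commute: "\<And>s. s \<in> S \<Longrightarrow> s \<otimes> t = t \<otimes> s"
  shows "g \<otimes> t = t \<otimes> g"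
proof -
  have mult: "g \<otimes> h \<otimes> t = t \<otimes> (g \<otimes> h)"
    if "g \<in> carrier G" "h \<in> carrier G" "g \<otimes> t = t \<otimes> g" "h \<otimes> t = t \<otimes> h" for g h
  proof -
    have "g \<otimes> h \<otimes> t = g \<otimes> (h \<otimes> t)" using that assms(3) by (simp only: m_assoc)
    also have "\<dots> = g \<otimes> t \<otimes> h" using that(1,2) assms(3) by (simp only: that(4) m_assoc)
    also have "\<dots> = t \<otimes> (g \<otimes> h)" using that(1,2) assms(3) by (simp only: that(3) m_assoc)
    finally show ?thesis .
  qed
  have inv: "inv s \<otimes> t = t \<otimes> inv s" if "s \<in> S" for s
  proof -
    have s: "s \<in> carrier G" using that assms(2) by blast
    have "inv s \<otimes> t = inv s \<otimes> (t \<otimes> s) \<otimes> inv s"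
      using s assms(3) by (simp add: m_assoc)
    also have "\<dots> = t \<otimes> inv s"
      using s assms(3) by (simp flip: commute[OF that] m_assoc)
    finally show ?thesis .
  qed
  show ?thesis
    using assms(1,2)
    by (induction rule: generate_induct_right) (use assms mult inv in auto)
qed

section \<open>The stabiliser of a row vector\<close>

text \<open>The pairs (N, m) = (1, 3), (2, 2), (3, 3) belong to p = 3, 4, 6. The defining relation
  enters through the centrality of \<open>(a b)^m\<close>, which for even p is equivalent to it; for
  type A2 the braid relation is added later.\<close>

locale artin_monodromy = group_hom G SL2Z \<rho>
  for G :: "('a, 'm) monoid_scheme" (structure) and \<rho> +
  fixes a b :: 'a and N m :: nat
  assumes a_closed [simp]: "a \<in> carrier G" and b_closed [simp]: "b \<in> carrier G"
    and generators: "carrier G = generate G {a, b}"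
    and \<rho>_a: "\<rho> a = mat2 1 0 (- int N) 1" and \<rho>_b: "\<rho> b = mat2 1 1 0 1"
    and N_m: "N = 1 \<and> m = 3 \<or> N = 2 \<and> m = 2 \<or> N = 3 \<and> m = 3"
    and power_central: "g \<in> carrier G \<Longrightarrow> g \<otimes> (a \<otimes> b) [^] m = (a \<otimes> b) [^] m \<otimes> g"
begin

abbreviation x :: 'a where "x \<equiv> a \<otimes> b"

definition z :: 'a where "z = x [^] m"

text \<open>A normal form, possible since \<open>z\<close> is central; the kernel computation reads
  off the exponents through \<open>\<rho>\<close>.\<close>

definition stab :: "'a set" where "stab = {b [^] i \<otimes> z [^] j |(i :: int) (j :: int). True}"

lemma z_closed [simp]: "z \<in> carrier G"
  by (simp add: z_def)

lemma z_commute: "g \<in> carrier G \<Longrightarrow> g \<otimes> z = z \<otimes> g"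
  by (simp add: z_def power_central)

lemma z_pow_commute:
  assumes "g \<in> carrier G" shows "g \<otimes> z [^] (j :: int) = z [^] j \<otimes> g"
proof -
  have "z [^] j \<in> generate G {z}" by (auto simp: G.generate_pow)
  then have "z [^] j \<otimes> g = g \<otimes> z [^] j"
    by (rule G.commute_generate) (use assms z_commute in auto)
  then show ?thesis ..
qed

lemma \<rho>_x: "\<rho> x = mat2 1 1 (- int N) (1 - int N)"
  by (simp add: \<rho>_a \<rho>_b mat2_mult)

lemma \<rho>_inv_a: "\<rho> (inv a) = mat2 1 0 (int N) 1"
  by (simp add: \<rho>_a inv_SL2Z)

lemma \<rho>_inv_b: "\<rho> (inv b) = mat2 1 (- 1) 0 1"
  by (simp add: \<rho>_b inv_SL2Z)

lemma \<rho>_inv_x: "\<rho> (inv x) = mat2 (1 - int N) (- 1) (int N) 1"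
  by (simp add: \<rho>_x inv_SL2Z G.m_closed[OF a_closed b_closed] del: hom_mult)

text \<open>\<open>\<rho> x\<close> has trace 2 - N and determinant 1, hence order 6, 4 or 3. The
  exponent \<open>m\<close> is half of this order for N = 1, 2, which gives -1, and all of it for N
  = 3. These orders are the exponents \<open>k_p\<close> of the theorem.\<close>

lemma \<rho>_z: "\<rho> z = (if N = 3 then mat2 1 0 0 1 else mat2 (- 1) 0 0 (- 1))"
  using N_m unfolding z_def
  by (auto simp: \<rho>_a \<rho>_b mat2_mult numeral_eq_Suc)

lemma \<rho>_b_pow: "\<rho> (b [^] (i :: int)) = mat2 1 i 0 1"
proof -
  have nat: "\<rho> (b [^] (n :: nat)) = mat2 1 (int n) 0 1" for n
    by (induction n) (simp_all add: \<rho>_b mat2_mult)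
  show ?thesis
  proof (cases i)
    case (nonneg n)
    then show ?thesis by (simp add: int_pow_int nat)
  next
    case (neg n)
    have "\<rho> (inv (b [^] Suc n)) = mat2 1 (- int (Suc n)) 0 1"
      unfolding hom_inv[OF G.nat_pow_closed[OF b_closed]] nat
      by (subst inv_SL2Z) simp_all
    then show ?thesis using neg by (metis G.int_pow_neg_int b_closed)
  qed
qed

lemma stab_subgroup: "subgroup stab G"
proof
  show "stab \<subseteq> carrier G" by (auto simp: stab_def)
  show "\<one> \<in> stab" unfolding stab_def by (auto intro!: exI[of _ 0])
next
  fix g h assume "g \<in> stab" "h \<in> stab"
  then obtain i j k l :: int where *: "g = b [^] i \<otimes> z [^] j" "h = b [^] k \<otimes> z [^] l"
    by (auto simp: stab_def)
  have "g \<otimes> h = b [^] i \<otimes> ((z [^] j \<otimes> b [^] k) \<otimes> z [^] l)"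
    by (simp add: * G.m_assoc)
  also have "\<dots> = b [^] (i + k) \<otimes> z [^] (j + l)"
    by (simp add: z_pow_commute[of "b [^] k", symmetric] G.int_pow_mult G.m_assoc)
  finally show "g \<otimes> h \<in> stab" by (auto simp: stab_def)
next
  fix g assume "g \<in> stab"
  then obtain i j :: int where *: "g = b [^] i \<otimes> z [^] j"
    by (auto simp: stab_def)
  have "inv g = b [^] - i \<otimes> z [^] - j"
    by (simp add: * G.inv_mult_group G.int_pow_neg[symmetric] z_pow_commute[of "b [^] - i"])
  then show "inv g \<in> stab" unfolding stab_def by blast
qed

lemma b_in_stab: "b \<in> stab" and z_in_stab: "z \<in> stab"
proof -
  have "b = b [^] (1 :: int) \<otimes> z [^] (0 :: int)" "z = b [^] (0 :: int) \<otimes> z [^] (1 :: int)"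
    by (simp_all add: G.int_pow_1)
  then show "b \<in> stab" "z \<in> stab" unfolding stab_def by blast+
qed

lemma stab_subset: "stab \<subseteq> carrier G"
  by (rule subgroup.subset[OF stab_subgroup])

lemma stab_coset_mult [simp]:
  "g \<in> carrier G \<Longrightarrow> h \<in> carrier G \<Longrightarrow> (stab #> g) #> h = stab #> (g \<otimes> h)"
  by (rule G.coset_mult_assoc[OF stab_subset])

lemma stab_coset_absorb:
  assumes "s \<in> stab" "g \<in> carrier G" shows "stab #> (s \<otimes> g) = stab #> g"
  using assms stab_subset
  by (metis G.coset_join2 G.coset_mult_assoc stab_subgroup subsetD)

lemma stab_coset_b [simp]: "g \<in> carrier G \<Longrightarrow> stab #> (b \<otimes> g) = stab #> g"
  by (rule stab_coset_absorb[OF b_in_stab])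

lemma stab_coset_b_one [simp]: "stab #> b = stab"
  by (rule G.coset_join2[OF b_closed stab_subgroup b_in_stab])

lemma stab_coset_inv_b [simp]: "g \<in> carrier G \<Longrightarrow> stab #> (inv b \<otimes> g) = stab #> g"
  by (rule stab_coset_absorb[OF subgroup.m_inv_closed[OF stab_subgroup b_in_stab]])

text \<open>The central \<open>z\<close> moves to the front, where \<open>stab\<close> absorbs
  it.\<close>

lemma stab_coset_z [simp]: "g \<in> carrier G \<Longrightarrow> stab #> (g \<otimes> z) = stab #> g"
  by (simp add: z_commute stab_coset_absorb[OF z_in_stab])

text \<open>Equivalent to (N c, d) being primitive, as the bottom row of a matrix of determinant 1
  must be. For N at most 3, a \<open>d\<close> coprime to N is 1 or -1 modulo N, so these are the
  bottom rows of \<open>Gamma1 N\<close> up to sign.\<close>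

definition admissible :: "int \<Rightarrow> int \<Rightarrow> bool" where
  "admissible c d \<longleftrightarrow> coprime c d \<and> coprime d (int N)"

definition has_row :: "'a \<Rightarrow> int \<Rightarrow> int \<Rightarrow> bool" where
  "has_row g c d \<longleftrightarrow> \<rho> g $ 2 $ 1 = int N * c \<and> \<rho> g $ 2 $ 2 = d"

lemma admissible_shift_a: "admissible (c + k * d) d \<longleftrightarrow> admissible c d"
proof -
  have "gcd (c + k * d) d = gcd c d"
    using gcd_add_mult[of d k c] by (simp only: add.commute gcd.commute)
  then show ?thesis unfolding admissible_def coprime_iff_gcd_eq_1 by simp
qed

lemma admissible_shift_b: "admissible c (d + k * (int N * c)) \<longleftrightarrow> admissible c d"
proof -
  have "coprime c (d + (k * int N) * c) \<longleftrightarrow> coprime c d"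
    by (metis coprime_iff_gcd_eq_1 gcd_add_mult add.commute)
  moreover have "coprime (int N) (d + (k * c) * int N) \<longleftrightarrow> coprime (int N) d"
    by (metis coprime_iff_gcd_eq_1 gcd_add_mult add.commute)
  ultimately show ?thesis
    unfolding admissible_def by (simp add: ac_simps)
qed

lemma has_row_mult:
  assumes "g \<in> carrier G" "has_row g c d"
  shows "has_row (g \<otimes> a) (c - d) d" "has_row (g \<otimes> inv a) (c + d) d"
    and "has_row (g \<otimes> b) c (d + int N * c)" "has_row (g \<otimes> inv b) c (d - int N * c)"
  using assms \<rho>_inv_a \<rho>_inv_b
  by (auto simp: has_row_def \<rho>_a \<rho>_b matrix_mult_nth_2 algebra_simps simp del: hom_inv)

lemma has_row_mult_x:
  assumes "g \<in> carrier G" "has_row g c d"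
  shows "has_row (g \<otimes> x) (c - d) (d + int N * (c - d))"
    and "has_row (g \<otimes> inv x) (c + (d - int N * c)) (d - int N * c)"
proof -
  show "has_row (g \<otimes> x) (c - d) (d + int N * (c - d))"
    using has_row_mult(3)[OF _ has_row_mult(1)[OF assms]] assms(1) by (simp add: G.m_assoc)
  show "has_row (g \<otimes> inv x) (c + (d - int N * c)) (d - int N * c)"
    using has_row_mult(2)[OF _ has_row_mult(4)[OF assms]] assms(1)
    by (simp add: G.m_assoc G.inv_mult_group)
qed

lemma inv_cancel [simp]:
  assumes "g \<in> carrier G" "h \<in> carrier G"
  shows "inv g \<otimes> (g \<otimes> h) = h" "g \<otimes> (inv g \<otimes> h) = h"
  using assms by (simp_all flip: G.m_assoc)

end

text \<open>A pair \<open>(c, d)\<close> encodes the bottom row \<open>(N c, d)\<close> up to sign; \<open>a\<close> and \<open>b\<close> act on pairs by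
  \<open>(c - d, d)\<close> and \<open>(c, d + N c)\<close>. An equivariant \<open>F\<close> shows that a group element is determined by
  its bottom row up to left multiplication by \<open>stab\<close>.\<close>

locale coset_section = artin_monodromy +
  fixes F :: "int \<Rightarrow> int \<Rightarrow> 'a set"
  assumes F_base: "F 0 1 = stab"
    and F_a: "admissible c d \<Longrightarrow> F (c - d) d = F c d #> a"
    and F_b: "admissible c d \<Longrightarrow> F c (d + int N * c) = F c d #> b"
    and F_row: "admissible c d \<Longrightarrow>
      \<exists>g\<in>carrier G. F c d = stab #> g \<and> (has_row g c d \<or> has_row g (- c) (- d))"
begin

lemma F_inv_a: "admissible c d \<Longrightarrow> F (c + d) d = F c d #> inv a"
  using F_a[of "c + d" d] F_row[of "c + d" d] admissible_shift_a[of c 1 d]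
  by (auto simp: G.m_assoc)

lemma F_inv_b: "admissible c d \<Longrightarrow> F c (d - int N * c) = F c d #> inv b"
  using F_b[of c "d - int N * c"] F_row[of c "d - int N * c"] admissible_shift_b[of c d "-1"]
  by (auto simp: G.m_assoc)

text \<open>A word for \<open>g\<close> is followed letter by letter, and row and coset change in
  parallel. Hence the sign, which \<open>F_row\<close> leaves open, is exact here, and elements with
  the same bottom row lie in the same coset of \<open>stab\<close>.\<close>

lemma coset_of_row:
  assumes "g \<in> carrier G"
  shows "\<exists>c d. admissible c d \<and> has_row g c d \<and> F c d = stab #> g"
proof -
  have "g \<in> generate G {a, b}" "{a, b} \<subseteq> carrier G"
    using assms by (simp_all flip: generators)
  then show ?thesis
  proof (induction rule: G.generate_induct_right)
    case one
    have "admissible 0 1 \<and> has_row \<one> 0 1 \<and> F 0 1 = stab #> \<one>"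
      by (simp add: admissible_def has_row_def F_base stab_subset)
    then show ?case by blast
  next
    case (mult g s)
    then obtain c d where *: "admissible c d" "has_row g c d" "F c d = stab #> g" by auto
    have "admissible (c - d) d" "F (c - d) d = stab #> (g \<otimes> a)"
      "admissible c (d + int N * c)" "F c (d + int N * c) = stab #> (g \<otimes> b)"
      using * \<open>g \<in> carrier G\<close> admissible_shift_a[of c "-1" d] admissible_shift_b[of c d 1]
      by (simp_all add: F_a F_b)
    moreover have "s = a \<or> s = b" using mult by blast
    ultimately show ?case using has_row_mult[OF \<open>g \<in> carrier G\<close> *(2)] by blast
  next
    case (mult_inv g s)
    then obtain c d where *: "admissible c d" "has_row g c d" "F c d = stab #> g" by auto
    have "admissible (c + d) d" "F (c + d) d = stab #> (g \<otimes> inv a)"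
      "admissible c (d - int N * c)" "F c (d - int N * c) = stab #> (g \<otimes> inv b)"
      using * \<open>g \<in> carrier G\<close> admissible_shift_a[of c 1 d] admissible_shift_b[of c d "-1"]
      by (simp_all add: F_inv_a F_inv_b)
    moreover have "s = a \<or> s = b" using mult_inv by blast
    ultimately show ?case using has_row_mult[OF \<open>g \<in> carrier G\<close> *(2)] by blast
  qed
qed

section \<open>Kernel and image of \<open>\<rho>\<close>\<close>

definition t :: 'a where "t = x [^] (if N = 3 then m else 2 * m)"

lemma t_closed [simp]: "t \<in> carrier G"
  by (simp add: t_def)

lemma t_eq: "t = z [^] (if N = 3 then 1 else 2 :: int)"
  using int_pow_int[of G z 2] G.nat_pow_pow[of x m 2]
  by (simp add: t_def z_def mult.commute del: int_pow_int)

lemma \<rho>_t: "\<rho> t = mat2 1 0 0 1"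
proof -
  have "z [^] (2 :: int) = z \<otimes> z"
    using G.int_pow_mult[of z 1 1] by (simp add: G.int_pow_1)
  then show ?thesis
    by (auto simp: t_eq \<rho>_z mat2_mult G.int_pow_1)
qed

lemma t_pow_commute: "g \<in> carrier G \<Longrightarrow> g \<otimes> t [^] (j :: int) = t [^] j \<otimes> g"
  unfolding t_eq by (simp only: G.int_pow_pow[OF z_closed] z_pow_commute)

lemma \<rho>_t_pow: "\<rho> (t [^] (j :: int)) = mat2 1 0 0 1"
  using hom_int_pow[of t j] H.int_pow_one[of j] by (simp add: \<rho>_t)

text \<open>An element acting trivially has bottom row (0, 1), so its coset is
  \<open>F 0 1 = stab\<close>; among the elements \<open>b^i z^j\<close> only the powers of
  \<open>t\<close> have trivial image.\<close>

lemma kernel_eq: "kernel G SL2Z \<rho> = generate G {t}"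
proof
  show "generate G {t} \<subseteq> kernel G SL2Z \<rho>"
    by (auto simp: G.generate_pow kernel_def \<rho>_t_pow)
next
  show "kernel G SL2Z \<rho> \<subseteq> generate G {t}"
  proof
    fix g assume "g \<in> kernel G SL2Z \<rho>"
    then have g: "g \<in> carrier G" "\<rho> g = mat2 1 0 0 1" by (auto simp: kernel_def)
    obtain c d where cd: "has_row g c d" "F c d = stab #> g"
      using coset_of_row[OF g(1)] by blast
    have "c = 0" "d = 1" using cd(1) g(2) N_m by (auto simp: has_row_def)
    then have "stab #> g = stab" using cd(2) F_base by simp
    then have "g \<in> stab" using G.coset_join1 g(1) stab_subgroup by blast
    then obtain i j :: int where ij: "g = b [^] i \<otimes> z [^] j" by (auto simp: stab_def)
    \<comment> \<open>Chosen so that \<open>t = z^e\<close>; then \<open>j mod e\<close> is the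
      exponent left over modulo powers of \<open>t\<close>.\<close>
    define e :: int where "e = (if N = 3 then 1 else 2)"
    have "t [^] (j div e) = z [^] (e * (j div e))"
      unfolding t_eq e_def[symmetric] by (rule G.int_pow_pow) simp
    then have z_pow: "z [^] j = t [^] (j div e) \<otimes> z [^] (j mod e)"
      using G.int_pow_mult[of z "e * (j div e)" "j mod e"] by simp
    then have r: "\<rho> g = mat2 1 i 0 1 ** \<rho> (z [^] (j mod e))"
      unfolding ij z_pow by (simp add: \<rho>_b_pow \<rho>_t_pow matrix_mul_assoc mat2_mult del: hom_int_pow)
    \<comment> \<open>The remainder 1 occurs only for e = 2, where \<open>\<rho> z = -1\<close>
      would put -1 on the diagonal of \<open>\<rho> g\<close>.\<close>
    have "j mod e = 0"
    proof (rule ccontr)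
      assume "j mod e \<noteq> 0"
      then have "N \<noteq> 3" "j mod e = 1" unfolding e_def by (auto split: if_splits)
      then show False using r g(2) by (simp add: G.int_pow_1 \<rho>_z mat2_eq_iff matrix_mult_nth_2)
    qed
    then have "i = 0" using r g(2) by (simp add: mat2_eq_iff matrix_mult_nth_2)
    have "g = t [^] (j div e)"
      using ij \<open>i = 0\<close> \<open>j mod e = 0\<close> z_pow by simp
    then show "g \<in> generate G {t}" by (auto simp: G.generate_pow)
  qed
qed

lemma image_subset: "\<rho> ` carrier G \<subseteq> Gamma1 N"
proof clarify
  fix g assume g: "g \<in> carrier G"
  then have "g \<in> generate G {a, b}" "{a, b} \<subseteq> carrier G"
    by (simp_all flip: generators)
  then have "[\<rho> g $ 1 $ 1 = 1] (mod int N) \<and> [\<rho> g $ 2 $ 2 = 1] (mod int N)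
      \<and> [\<rho> g $ 2 $ 1 = 0] (mod int N)"
  proof (induction rule: G.generate_induct_right)
    case (mult g s)
    then show ?case
      by (auto simp: \<rho>_a \<rho>_b matrix_mult_nth_2 cong_iff_dvd_diff algebra_simps)
  next
    case (mult_inv g s)
    then show ?case
      by (auto simp: \<rho>_inv_a \<rho>_inv_b matrix_mult_nth_2 cong_iff_dvd_diff algebra_simps simp del: hom_inv)
  qed auto
  moreover have "\<rho> g \<in> carrier SL2Z" using g hom_closed by blast
  ultimately show "\<rho> g \<in> Gamma1 N" unfolding Gamma1_def by blast
qed

text \<open>Matrices of determinant 1 with the same bottom row differ by a power of
  \<open>\<rho> b\<close> on the left. It therefore suffices to realise every admissible row, which
  \<open>F_row\<close> does up to sign.\<close>

lemma image_eq: "\<rho> ` carrier G = Gamma1 N"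
proof (rule antisym[OF image_subset])
  show "Gamma1 N \<subseteq> \<rho> ` carrier G"
  proof
    fix A assume A: "A \<in> Gamma1 N"
    then have SL: "A \<in> carrier SL2Z" by (simp add: Gamma1_def)
    obtain c where c: "A $ 2 $ 1 = int N * c"
      using A by (auto simp: Gamma1_def cong_0_iff)
    define d where "d = A $ 2 $ 2"
    have "coprime (int N * c) d" using coprime_matrix_row_2[OF SL] c by (simp add: d_def)
    then have "admissible c d"
      by (simp add: admissible_def coprime_commute)
    then obtain g where g: "g \<in> carrier G" "has_row g c d \<or> has_row g (- c) (- d)"
      using F_row by blast
    \<comment> \<open>A wrong sign is corrected by \<open>z\<close>, which acts as -1 when N is 1 or
      2; it cannot occur when N = 3, since 1 and -1 differ modulo 3.\<close>
    obtain h where h: "h \<in> carrier G" "has_row h c d"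
    proof (cases "has_row g c d")
      case False
      then have neg: "has_row g (- c) (- d)" using g by blast
      have "N \<noteq> 3"
      proof
        assume "N = 3"
        have "\<rho> g \<in> Gamma1 N" using image_subset g(1) by blast
        then have "[- d = 1] (mod 3)" "[d = 1] (mod 3)"
          using neg A \<open>N = 3\<close> unfolding Gamma1_def has_row_def d_def by simp_all
        then show False by (auto simp: cong_iff_dvd_diff; presburger)
      qed
      then have "has_row (g \<otimes> z) c d"
        using neg g(1) by (simp add: has_row_def \<rho>_z matrix_mult_nth_2)
      from that[OF _ this] g(1) show thesis by simp
    qed (use that g in blast)
    define B where "B = \<rho> h"
    have B: "B \<in> carrier SL2Z" "B $ 2 $ 1 = A $ 2 $ 1" "B $ 2 $ 2 = A $ 2 $ 2"
      using h hom_closed[of h] unfolding B_def has_row_def c d_def by simp_all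
    \<comment> \<open>The upper right entry of \<open>A B^{-1}\<close>, which is upper
      unipotent.\<close>
    define k where "k = A $ 1 $ 2 * B $ 1 $ 1 - A $ 1 $ 1 * B $ 1 $ 2"
    have detA: "A $ 1 $ 1 * A $ 2 $ 2 = 1 + A $ 1 $ 2 * A $ 2 $ 1"
      and detB: "B $ 1 $ 1 * A $ 2 $ 2 = 1 + B $ 1 $ 2 * A $ 2 $ 1"
      using SL B by simp_all
    have "A $ 1 $ 1 = B $ 1 $ 1 + k * A $ 2 $ 1" "A $ 1 $ 2 = B $ 1 $ 2 + k * A $ 2 $ 2"
      unfolding k_def using detA detB by algebra+
    then have "A = mat2 1 k 0 1 ** B"
      by (simp add: mat2_eq_iff matrix_mult_nth_2 B)
    then have "A = \<rho> (b [^] k \<otimes> h)"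
      using h(1) by (simp add: \<rho>_b_pow B_def)
    then show "A \<in> \<rho> ` carrier G" by (rule image_eqI) (simp add: h(1))
  qed
qed

end

section \<open>Types B2 and G2\<close>

locale artin_monodromy_even = artin_monodromy +
  assumes N_ge_2: "N \<ge> 2"
begin

lemma N_cases: "N = 2 \<and> m = 2 \<or> N = 3 \<and> m = 3"
  using N_m N_ge_2 by auto

text \<open>On the slope \<open>s = c / d\<close>, the element \<open>a\<close> acts as translation by \<open>-1\<close>. For \<open>N = 2\<close>, \<open>x\<close> exchanges
  \<open>(0, 1)\<close> with the complement of \<open>[0, 1]\<close>; for \<open>N = 3\<close> it cyclically permutes \<open>(0, 1/2)\<close>, \<open>(1/2, 1)\<close> and
  that complement. Outside \<open>[0, 1]\<close> we translate towards it; inside, \<open>x\<close> or its inverse decreases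
  \<open>\<bar>d\<bar>\<close>. The value at \<open>d = 0\<close> is irrelevant.\<close>

function cosets :: "int \<Rightarrow> int \<Rightarrow> 'a set" where
  "cosets c d =
    (if d < 0 then cosets (- c) (- d)
     else if d = 0 \<or> c = 0 then stab
     else if c = d then stab #> inv a
     else if d = 2 * c then stab #> x
     else if d < c then cosets (c - d) d #> inv a
     else if c < 0 then cosets (c + d) d #> a
     else if d < 2 * c then cosets (c - d) (d + int N * (c - d)) #> inv x
     else cosets (c + (d - int N * c)) (d - int N * c) #> x)"
  by pat_completeness auto
termination
  \<comment> \<open>The quantity |2 c - d| is the distance of the slope from 1/2, the midpoint of
    [0, 1], scaled by 2 |d|. The translations keep \<open>d\<close> and decrease it.\<close>
  by (relation "measures [\<lambda>(c, d). nat \<bar>d\<bar>, \<lambda>(c, d). nat \<bar>2 * c - d\<bar>, \<lambda>(c, d). if d < 0 then 1 else 0]")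
    (use N_cases in auto)

declare cosets.simps [simp del]

text \<open>The existence of \<open>g\<close> is independent of admissibility, so the rules for
  multiplying cosets hold for all arguments. The row does need it: coprimality fixes the vector in
  the terminal cases. The sign is lost at (1, 2), since for N = 3 the row of \<open>x\<close> is
  (-1, -2).\<close>

lemma cosets_row:
  "\<exists>g\<in>carrier G. cosets c d = stab #> g \<and>
    (admissible c d \<longrightarrow> has_row g c d \<or> has_row g (- c) (- d))"
proof (induction c d rule: cosets.induct)
  case (1 c d)
  have step: ?case
    if "\<exists>g\<in>carrier G. cosets c' d' = stab #> g \<and>
        (admissible c' d' \<longrightarrow> has_row g c' d' \<or> has_row g (- c') (- d'))"
      and "cosets c d = cosets c' d' #> h" "h \<in> carrier G"
      and "admissible c d \<Longrightarrow> admissible c' d'"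
      and "\<And>g. g \<in> carrier G \<Longrightarrow> has_row g c' d' \<Longrightarrow> has_row (g \<otimes> h) c d"
      and "\<And>g. g \<in> carrier G \<Longrightarrow> has_row g (- c') (- d') \<Longrightarrow> has_row (g \<otimes> h) (- c) (- d)"
    for c' d' h
  proof -
    from that(1) obtain g where "g \<in> carrier G" "cosets c' d' = stab #> g"
      "admissible c' d' \<longrightarrow> has_row g c' d' \<or> has_row g (- c') (- d')" by blast
    then show ?thesis using that(2-) by (intro bexI[of _ "g \<otimes> h"]) auto
  qed
  consider "d < 0" | "d = 0" | "c = 0" "d > 0" | "c = d" "d > 0" | "d = 2 * c" "d > 0"
    | "d < c" "d > 0" | "c < 0" "d > 0" | "d > 0" "c < d" "d < 2 * c" | "c > 0" "2 * c < d"
    by linarith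
  then show ?case
  proof cases
    case 1
    have "admissible c d \<longleftrightarrow> admissible (- c) (- d)" by (simp add: admissible_def)
    with 1 "1.IH"(1) show ?thesis by (simp add: cosets.simps[of c d]) blast
  next
    case 2
    then have "\<not> admissible c d" using N_cases unfolding admissible_def by auto
    moreover have "cosets c d = stab #> \<one>"
      using 2 by (subst cosets.simps) (simp add: stab_subset)
    ultimately show ?thesis by blast
  next
    case 3
    then have "cosets c d = stab #> \<one>" by (subst cosets.simps) (simp add: stab_subset)
    moreover have "has_row \<one> c d" if "admissible c d"
      using 3 that by (simp add: admissible_def has_row_def)
    ultimately show ?thesis by blast
  next
    case 4
    then have "cosets c d = stab #> inv a" by (subst cosets.simps) simp
    moreover have "has_row (inv a) c d" if "admissible c d"
      using 4 that \<rho>_inv_a by (simp add: admissible_def has_row_def del: hom_inv)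
    ultimately show ?thesis by (intro bexI[of _ "inv a"]) simp_all
  next
    case 5
    then have "cosets c d = stab #> x" by (subst cosets.simps) simp
    moreover have "has_row x (- c) (- d)" if "admissible c d"
    proof -
      have "c = 1" "N = 3" using 5 that N_cases unfolding admissible_def by auto
      then show ?thesis unfolding has_row_def using 5 \<rho>_x by (simp del: hom_mult)
    qed
    ultimately show ?thesis by (intro bexI[of _ x]) simp_all
  next
    case 6
    show ?thesis
    proof (rule step[where h = "inv a"])
      show "\<exists>g\<in>carrier G. cosets (c - d) d = stab #> g \<and>
          (admissible (c - d) d \<longrightarrow> has_row g (c - d) d \<or> has_row g (- (c - d)) (- d))"
        using "1.IH" 6 by simp
    qed (use 6 admissible_shift_a[of c "-1" d] has_row_mult(2)[of _ "c - d" d]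
          has_row_mult(2)[of _ "- (c - d)" "- d"] in \<open>auto simp: cosets.simps[of c d]\<close>)
  next
    case 7
    show ?thesis
    proof (rule step[where h = a])
      show "\<exists>g\<in>carrier G. cosets (c + d) d = stab #> g \<and>
          (admissible (c + d) d \<longrightarrow> has_row g (c + d) d \<or> has_row g (- (c + d)) (- d))"
        using "1.IH" 7 by simp
    qed (use 7 admissible_shift_a[of c 1 d] has_row_mult(1)[of _ "c + d" d]
          has_row_mult(1)[of _ "- (c + d)" "- d"] in \<open>auto simp: cosets.simps[of c d]\<close>)
  next
    case 8
    let ?c = "c - d" and ?d = "d + int N * (c - d)"
    show ?thesis
    proof (rule step[where h = "inv x"])
      show "\<exists>g\<in>carrier G. cosets ?c ?d = stab #> g \<and>
          (admissible ?c ?d \<longrightarrow> has_row g ?c ?d \<or> has_row g (- ?c) (- ?d))"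
        using "1.IH" 8 by simp
      show "admissible c d \<Longrightarrow> admissible ?c ?d"
        using admissible_shift_a[of c "-1" d] admissible_shift_b[of "c - d" d 1] by simp
    qed (use 8 has_row_mult_x(2)[of _ ?c ?d] has_row_mult_x(2)[of _ "- ?c" "- ?d"]
          in \<open>auto simp: cosets.simps[of c d] algebra_simps\<close>)
  next
    case 9
    let ?c = "c + (d - int N * c)" and ?d = "d - int N * c"
    show ?thesis
    proof (rule step[where h = x])
      show "\<exists>g\<in>carrier G. cosets ?c ?d = stab #> g \<and>
          (admissible ?c ?d \<longrightarrow> has_row g ?c ?d \<or> has_row g (- ?c) (- ?d))"
        using "1.IH" 9 by simp
      show "admissible c d \<Longrightarrow> admissible ?c ?d"
        using admissible_shift_a[of c 1 ?d] admissible_shift_b[of c d "-1"] by simp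
    qed (use 9 has_row_mult_x(1)[of _ ?c ?d] has_row_mult_x(1)[of _ "- ?c" "- ?d"]
          in \<open>auto simp: cosets.simps[of c d] algebra_simps\<close>)
  qed
qed

section \<open>Equivariance in types B2 and G2\<close>

lemma cosets_mult [simp]:
  "g \<in> carrier G \<Longrightarrow> h \<in> carrier G \<Longrightarrow> (cosets c d #> g) #> h = cosets c d #> (g \<otimes> h)"
  "cosets c d #> \<one> = cosets c d"
  "g \<in> carrier G \<Longrightarrow> cosets c d #> (g \<otimes> z) = cosets c d #> g"
  "cosets c d #> z = cosets c d"
proof -
  obtain g' where g': "g' \<in> carrier G" "cosets c d = stab #> g'"
    using cosets_row by blast
  show "g \<in> carrier G \<Longrightarrow> h \<in> carrier G \<Longrightarrow> (cosets c d #> g) #> h = cosets c d #> (g \<otimes> h)"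
    using g' by (simp add: G.m_assoc)
  show "cosets c d #> \<one> = cosets c d" "cosets c d #> z = cosets c d"
    using g' by simp_all
  show "cosets c d #> (g \<otimes> z) = cosets c d #> g" if "g \<in> carrier G"
    using g' that stab_coset_z[of "g' \<otimes> g"] by (simp add: G.m_assoc)
qed

lemma cosets_neg: "cosets (- c) (- d) = cosets c d"
proof -
  consider "d < 0" | "d = 0" | "d > 0" by linarith
  then show ?thesis
    by cases (simp_all add: cosets.simps[of c d] cosets.simps[of "- c" "- d"]
      cosets.simps[of c 0] cosets.simps[of "- c" 0])
qed

lemma cosets_base: "cosets 0 d = stab" "c > 0 \<Longrightarrow> cosets c c = stab #> inv a"
  "c > 0 \<Longrightarrow> cosets c (2 * c) = stab #> x"
proof -
  have "cosets 0 d = stab" if "d \<ge> 0" for d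
    using that by (subst cosets.simps) simp
  from this[of d] this[of "- d"] show "cosets 0 d = stab"
    using cosets_neg[of 0 d] by (cases "d \<ge> 0") simp_all
qed (subst cosets.simps, simp)+

text \<open>Unless s = 1, at least one of the slopes s and s - 1 lies outside [0, 1]; unfolding
  \<open>cosets\<close> there gives exactly this translation step.\<close>

lemma cosets_a:
  assumes "d \<noteq> 0" shows "cosets (c - d) d = cosets c d #> a"
proof -
  have pos: "cosets (c - d) d = cosets c d #> a" if "d > 0" for c d
  proof -
    consider "c > d" | "c = d" | "c < d" by linarith
    then show ?thesis
    proof cases
      case 1
      then have "cosets c d = cosets (c - d) d #> inv a"
        using \<open>d > 0\<close> by (subst cosets.simps) simp
      then show ?thesis by simp
    next
      case 2
      then show ?thesis using \<open>d > 0\<close> by (simp add: cosets_base stab_subset)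
    next
      case 3
      then show ?thesis using \<open>d > 0\<close> by (subst cosets.simps) simp
    qed
  qed
  show ?thesis
  proof (cases "d > 0")
    case False
    then have "cosets (- c - - d) (- d) = cosets (- c) (- d) #> a" using assms by (intro pos) simp
    then show ?thesis using cosets_neg[of "c - d" d] by (simp add: cosets_neg)
  qed (rule pos)
qed

text \<open>The condition means 0 < c/d < 1/2; as a product it is invariant under changing both
  signs, so vectors with negative \<open>d\<close> are covered too.\<close>

lemma cosets_lower_half:
  assumes "0 < c * (d - 2 * c)"
  shows "cosets c d = cosets (c + (d - int N * c)) (d - int N * c) #> x"
proof -
  have pos: "cosets c d = cosets (c + (d - int N * c)) (d - int N * c) #> x"
    if "0 < c" "2 * c < d" for c d
    using that by (subst cosets.simps) simp
  consider "0 < c" "2 * c < d" | "0 < - c" "2 * - c < - d"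
    using assms by (auto simp: zero_less_mult_iff)
  then show ?thesis
    using pos[of c d] pos[of "- c" "- d"] cosets_neg[of "c + (d - int N * c)" "d - int N * c"]
    by cases (simp_all add: cosets_neg)
qed

lemma cosets_upper_half:
  assumes "0 < (2 * c - d) * (d - c)"
  shows "cosets c d = cosets (c - d) (d + int N * (c - d)) #> inv x"
proof -
  have pos: "cosets c d = cosets (c - d) (d + int N * (c - d)) #> inv x"
    if "c < d" "d < 2 * c" for c d
    using that by (subst cosets.simps) simp
  consider "c < d" "d < 2 * c" | "- c < - d" "- d < 2 * - c"
    using assms by (auto simp: zero_less_mult_iff)
  then show ?thesis
    using pos[of c d] pos[of "- c" "- d"] cosets_neg[of "c - d" "d + int N * (c - d)"]
    by cases (simp_all add: cosets_neg algebra_simps)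
qed

text \<open>Every coset absorbs \<open>z = x^m\<close>, so \<open>x^(m-1)\<close> and
  \<open>x^(-1)\<close> multiply alike.\<close>

lemma cosets_x_mod:
  shows "m = 2 \<Longrightarrow> cosets c d #> inv x = cosets c d #> x"
    and "m = 3 \<Longrightarrow> cosets c d #> (x \<otimes> x) = cosets c d #> inv x"
proof -
  have closed: "x \<in> carrier G" "inv x \<in> carrier G" "x \<otimes> x \<in> carrier G" by simp_all
  {
    assume "m = 2"
    then have "z = x \<otimes> x" unfolding z_def by (simp add: numeral_eq_Suc)
    then have "x = inv x \<otimes> z" using inv_cancel(1)[OF closed(1) closed(1)] by simp
    then show "cosets c d #> inv x = cosets c d #> x"
      using cosets_mult(3)[OF closed(2)] by metis
  next
    assume "m = 3"
    then have "z = x \<otimes> (x \<otimes> x)"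
      unfolding z_def using closed(1) by (simp add: numeral_eq_Suc G.m_assoc)
    then have "x \<otimes> x = inv x \<otimes> z" using inv_cancel(1)[OF closed(1) closed(3)] by simp
    then show "cosets c d #> (x \<otimes> x) = cosets c d #> inv x"
      using cosets_mult(3)[OF closed(2)] by metis
  }
qed

text \<open>\<open>x\<close> moves slopes by 0 -> 1 -> 0 for N = 2 and by 0 -> 1/2 -> 1 -> 0 for N =
  3. Between an inner interval and the complement of [0, 1] the recursion provides a step by
  \<open>x\<close> or by its inverse; the moves it does not provide follow because \<open>x\<close>
  has order \<open>m\<close> on cosets.\<close>

lemma cosets_x:
  assumes "admissible c d"
  shows "cosets (c - d) (d + int N * (c - d)) = cosets c d #> x"
proof -
  have pos: "cosets (c - d) (d + int N * (c - d)) = cosets c d #> x"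
    if adm: "admissible c d" and "d > 0" for c d
  proof -
    \<comment> \<open>Here \<open>x^(-1) = b^(-1) a^(-1)\<close>, and \<open>stab\<close> absorbs
      the first factor.\<close>
    have inv_x: "cosets 0 1 #> inv x = stab #> inv a"
      using stab_coset_inv_b[of "inv a"] by (simp add: cosets_base G.inv_mult_group)
    have coprime: "coprime c d" "coprime d (int N)" using adm by (simp_all add: admissible_def)
    consider "c = 0" | "c = d" | "d = 2 * c" | "0 < c" "2 * c < d"
      | "c < d" "d < 2 * c" | "c < 0 \<or> d < c"
      using \<open>d > 0\<close> by linarith
    then show ?thesis
    proof cases
      case 1
      then have "d = 1" using coprime \<open>d > 0\<close> by simp
      consider "m = 2" "int N = 2" | "m = 3" "int N = 3" using N_cases by auto
      then show ?thesis
      proof cases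
        case 1
        have "cosets (- 1) (- 1) = cosets 0 1 #> x"
          using cosets_x_mod(1)[OF 1(1), of 0 1] cosets_neg[of 1 1] cosets_base(2)[of 1] inv_x by simp
        then show ?thesis by (simp add: \<open>c = 0\<close> \<open>d = 1\<close> 1(2))
      next
        case 2
        have "cosets (- 1) (- 2) = cosets 0 1 #> x"
          using cosets_neg[of 1 2] cosets_base(1)[of 1] cosets_base(3)[of 1] by simp
        then show ?thesis by (simp add: \<open>c = 0\<close> \<open>d = 1\<close> 2(2))
      qed
    next
      case 2
      then show ?thesis using \<open>d > 0\<close> by (simp add: cosets_base stab_subset)
    next
      case 3
      then have "c = 1" using coprime \<open>d > 0\<close> by simp
      then have "odd (int N)" using coprime 3 by simp
      then have N3: "m = 3" "int N = 3" using N_cases by auto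
      have "cosets (- 1) (- 1) = cosets 1 2 #> x"
        using cosets_x_mod(2)[OF N3(1), of 0 1] cosets_neg[of 1 1] cosets_base(2)[of 1]
          cosets_base(1)[of 1] cosets_base(3)[of 1] inv_x by simp
      then show ?thesis by (simp add: 3 \<open>c = 1\<close> N3(2))
    next
      case 4
      consider "m = 2" "int N = 2" | "m = 3" "int N = 3" using N_cases by auto
      then show ?thesis
      proof cases
        case 1
        have "cosets c d = cosets (d - c) (d - 2 * c) #> x"
          using cosets_lower_half[of c d] 4 by (simp add: 1(2))
        then have "cosets (d - c) (d - 2 * c) = cosets c d #> x"
          using cosets_x_mod(1)[OF 1(1), of c d] by simp
        then show ?thesis
          using cosets_neg[of "d - c" "d - 2 * c"] by (simp add: 1(2))
      next
        case 2
        \<comment> \<open>Both (c, d) and its image are compared with (d - 2 c, d - 3 c), whose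
          slope lies outside [0, 1]: the recursion reaches one from it by \<open>x\<close> and the
          other by \<open>x^(-1)\<close>.\<close>
        have "cosets c d = cosets (d - 2 * c) (d - 3 * c) #> x"
          using cosets_lower_half[of c d] 4 by (simp add: 2(2))
        moreover have "cosets (c - d) (3 * c - 2 * d) = cosets (d - 2 * c) (d - 3 * c) #> inv x"
          using cosets_upper_half[of "c - d" "3 * c - 2 * d"] 4
          by (simp add: 2(2) mult_less_0_iff)
        ultimately have "cosets (c - d) (3 * c - 2 * d) = cosets c d #> x"
          using cosets_x_mod(2)[OF 2(1)] by simp
        then show ?thesis by (simp add: 2(2))
      qed
    next
      case 5
      then have "cosets c d = cosets (c - d) (d + int N * (c - d)) #> inv x"
        by (intro cosets_upper_half) simp
      then show ?thesis by simp
    next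
      case 6
      then have "0 < c * (c - d)" using \<open>d > 0\<close> by (auto simp: zero_less_mult_iff)
      \<comment> \<open>\<open>x\<close> maps slopes above 1 into (0, 1/2). Negative slopes go there
        as well for N = 3, but into (1/2, 1) for N = 2, where the recursion steps by
        \<open>x^(-1)\<close> instead.\<close>
      consider "int N = 3 \<or> int N = 2 \<and> d < c" | "m = 2" "int N = 2" "c < 0"
        using 6 N_cases by auto
      then show ?thesis
      proof cases
        case 1
        define e where "e = d + int N * (c - d)"
        have "0 < (c - d) * (e - 2 * (c - d))"
          using 1
        proof
          assume *: "int N = 3"
          show ?thesis using \<open>0 < c * (c - d)\<close> unfolding e_def * by (simp add: algebra_simps)
        next
          assume *: "int N = 2 \<and> d < c"
          show ?thesis using * \<open>d > 0\<close> unfolding e_def conjunct1[OF *] by simp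
        qed
        then have "cosets (c - d) e = cosets c d #> x"
          using cosets_lower_half[of "c - d" e] by (simp add: e_def)
        then show ?thesis by (simp add: e_def)
      next
        case 2
        have "cosets (c - d) (2 * c - d) = cosets (- c) (- d) #> inv x"
          using cosets_upper_half[of "c - d" "2 * c - d"] 2(3) \<open>d > 0\<close>
          by (simp add: 2(2) mult_less_0_iff)
        then show ?thesis using cosets_x_mod(1)[OF 2(1)] by (simp add: cosets_neg 2(2))
      qed
    qed
  qed
  show ?thesis
  proof (cases "d > 0")
    case False
    have "d \<noteq> 0" "admissible (- c) (- d)"
      using assms N_cases unfolding admissible_def by auto
    with False have "cosets (- c - - d) (- d + int N * (- c - - d)) = cosets (- c) (- d) #> x"
      by (intro pos) simp_all
    then show ?thesis using cosets_neg[of "c - d" "d + int N * (c - d)"]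
      by (simp add: cosets_neg algebra_simps)
  qed (use assms pos in blast)
qed


text \<open>Obtained from \<open>b = a^(-1) x\<close>: the vector (c + d, d) goes to (c, d) under
  \<open>a\<close> and to (c, d + N c) under \<open>x\<close>.\<close>

lemma cosets_b:
  assumes "admissible c d" shows "cosets c (d + int N * c) = cosets c d #> b"
proof -
  have "d \<noteq> 0" using assms N_cases unfolding admissible_def by auto
  have "admissible (c + d) d" using assms admissible_shift_a[of c 1 d] by simp
  from cosets_x[OF this] have "cosets c (d + int N * c) = cosets (c + d) d #> x" by simp
  moreover have "cosets c d = cosets (c + d) d #> a"
    using cosets_a[OF \<open>d \<noteq> 0\<close>, of "c + d"] by simp
  ultimately show ?thesis by simp
qed

sublocale coset_section G \<rho> a b N m cosets
proof
  show "cosets 0 1 = stab" by (simp add: cosets_base)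
  show "cosets (c - d) d = cosets c d #> a" if "admissible c d" for c d
    using that N_cases unfolding admissible_def by (intro cosets_a) auto
qed (use cosets_b cosets_row in blast)+

end

section \<open>Type A2\<close>

locale artin_monodromy_braid = artin_monodromy +
  assumes N_eq_1: "N = 1" and braid: "a \<otimes> b \<otimes> a = b \<otimes> a \<otimes> b"
begin

lemma int_N: "int N = 1"
  using N_eq_1 by simp

lemma z_eq: "z = x \<otimes> (x \<otimes> x)"
proof -
  have "m = 3" using N_m N_eq_1 by auto
  then have "z = x [^] (3 :: nat)" unfolding z_def by simp
  then show ?thesis by (simp add: numeral_eq_Suc G.m_assoc)
qed

text \<open>The element Delta. It acts on slopes by s -> -1/s and has square
  \<open>z\<close>.\<close>

abbreviation y :: 'a where "y \<equiv> x \<otimes> a"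

lemma y_eq: "y = b \<otimes> x"
  using braid by (simp add: G.m_assoc)

lemma y_square: "y \<otimes> y = z"
proof -
  have "y \<otimes> y = y \<otimes> (b \<otimes> x)"
    by (rule arg_cong[OF y_eq])
  also have "\<dots> = z" by (simp add: z_eq G.m_assoc)
  finally show ?thesis .
qed

text \<open>Needed at infinite slope, where it shows that \<open>stab\<close> absorbs
  \<open>x y\<close>.\<close>

lemma x_y: "x \<otimes> y = inv b \<otimes> z"
proof -
  have "y \<otimes> y = b \<otimes> (x \<otimes> y)" by (simp add: y_eq[symmetric] G.m_assoc[symmetric])
  then show ?thesis by (simp flip: y_square)
qed

lemma has_row_mult_y:
  assumes "g \<in> carrier G" "has_row g c d"
  shows "has_row (g \<otimes> y) (- d) c" "has_row (g \<otimes> inv y) d (- c)"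
proof -
  have "has_row (g \<otimes> x \<otimes> a) (- d) (d + (c - d))"
    using has_row_mult(1)[OF _ has_row_mult_x(1)[OF assms]] assms(1) by (simp add: int_N)
  then show "has_row (g \<otimes> y) (- d) c"
    using assms(1) by (simp add: G.m_assoc)
  have "has_row (g \<otimes> inv a \<otimes> inv x) (c + d + (d - (c + d))) (d - (c + d))"
    using has_row_mult_x(2)[OF _ has_row_mult(2)[OF assms]] assms(1) by (simp add: int_N)
  then show "has_row (g \<otimes> inv y) d (- c)"
    using assms(1) by (simp add: G.m_assoc G.inv_mult_group)
qed

text \<open>On the slope \<open>s = c / d\<close>, \<open>x\<close> cyclically permutes the intervals \<open>(0, 1)\<close>, \<open>(-\<infinity>, 0)\<close>, \<open>(1, \<infinity>)\<close>,
  and \<open>y\<close> exchanges positive and negative slopes.\<close>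

function cosets :: "int \<Rightarrow> int \<Rightarrow> 'a set" where
  "cosets c d =
    (if c < 0 then cosets (- c) (- d)
     else if c = 0 then stab
     else if d = 0 then stab #> x
     else if c = d then stab #> inv x
     else if d < 0 then cosets (- d) c #> inv y
     else if c < d then cosets (c - d) c #> inv x
     else cosets d (d - c) #> x)"
  by pat_completeness auto
termination
  \<comment> \<open>The sum |c| + |d| drops in the steps that multiply by \<open>x\<close> or its
    inverse; the step with \<open>y\<close> keeps it but turns a negative slope into a positive
    one.\<close>
  by (relation "measures [\<lambda>(c, d). nat (\<bar>c\<bar> + \<bar>d\<bar>), \<lambda>(c, d). if c * d < 0 then 1 else 0,
      \<lambda>(c, d). if c < 0 then 1 else 0]")
    (auto simp: mult_less_0_iff)

declare cosets.simps [simp del]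

lemma cosets_row:
  "\<exists>g\<in>carrier G. cosets c d = stab #> g \<and>
    (admissible c d \<longrightarrow> has_row g c d \<or> has_row g (- c) (- d))"
proof (induction c d rule: cosets.induct)
  case (1 c d)
  have step: ?case
    if "\<exists>g\<in>carrier G. cosets c' d' = stab #> g \<and>
        (admissible c' d' \<longrightarrow> has_row g c' d' \<or> has_row g (- c') (- d'))"
      and "cosets c d = cosets c' d' #> h" "h \<in> carrier G"
      and "coprime c d \<Longrightarrow> coprime c' d'"
      and "\<And>g. g \<in> carrier G \<Longrightarrow> has_row g c' d' \<Longrightarrow> has_row (g \<otimes> h) c d"
      and "\<And>g. g \<in> carrier G \<Longrightarrow> has_row g (- c') (- d') \<Longrightarrow> has_row (g \<otimes> h) (- c) (- d)"
    for c' d' h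
  proof -
    from that(1) obtain g where "g \<in> carrier G" "cosets c' d' = stab #> g"
      "admissible c' d' \<longrightarrow> has_row g c' d' \<or> has_row g (- c') (- d')" by blast
    then show ?thesis using that(2-) by (intro bexI[of _ "g \<otimes> h"]) (auto simp: admissible_def int_N)
  qed
  consider "c < 0" | "c = 0" | "c > 0" "d = 0" | "c = d" "c > 0" | "c > 0" "d < 0"
    | "c > 0" "c < d" | "d > 0" "d < c"
    by linarith
  then show ?case
  proof cases
    case 1
    have "admissible c d \<longleftrightarrow> admissible (- c) (- d)" by (simp add: admissible_def)
    with 1 "1.IH"(1) show ?thesis by (simp add: cosets.simps[of c d]) blast
  next
    case 2
    then have "cosets c d = stab #> \<one>" by (subst cosets.simps) (simp add: stab_subset)
    moreover have "has_row \<one> c d \<or> has_row \<one> (- c) (- d)" if "admissible c d"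
      using 2 that by (auto simp: admissible_def has_row_def)
    ultimately show ?thesis by blast
  next
    case 3
    then have "cosets c d = stab #> x" by (subst cosets.simps) simp
    moreover have "has_row x (- c) (- d)" if "admissible c d"
      using 3 that \<rho>_x unfolding admissible_def has_row_def int_N by (simp del: hom_mult)
    ultimately show ?thesis by (intro bexI[of _ x]) simp_all
  next
    case 4
    then have "cosets c d = stab #> inv x" by (subst cosets.simps) simp
    moreover have "has_row (inv x) c d" if "admissible c d"
      using 4 that \<rho>_inv_x unfolding admissible_def has_row_def int_N by (simp del: hom_inv)
    ultimately show ?thesis by (intro bexI[of _ "inv x"]) simp_all
  next
    case 5
    show ?thesis
    proof (rule step[where h = "inv y"])
      show "\<exists>g\<in>carrier G. cosets (- d) c = stab #> g \<and>
          (admissible (- d) c \<longrightarrow> has_row g (- d) c \<or> has_row g (- (- d)) (- c))"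
        using "1.IH" 5 by simp
      show "cosets c d = cosets (- d) c #> inv y"
        using 5 by (subst cosets.simps) simp
      show "has_row (g \<otimes> inv y) c d" if "g \<in> carrier G" "has_row g (- d) c" for g
        using has_row_mult_y(2)[OF that] by simp
      show "has_row (g \<otimes> inv y) (- c) (- d)" if "g \<in> carrier G" "has_row g (- (- d)) (- c)" for g
        using has_row_mult_y(2)[OF that] by simp
    qed (simp_all add: coprime_commute)
  next
    case 6
    show ?thesis
    proof (rule step[where h = "inv x"])
      show "\<exists>g\<in>carrier G. cosets (c - d) c = stab #> g \<and>
          (admissible (c - d) c \<longrightarrow> has_row g (c - d) c \<or> has_row g (- (c - d)) (- c))"
        using "1.IH" 6 by simp
      show "cosets c d = cosets (c - d) c #> inv x"
        using 6 by (subst cosets.simps) simp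
      show "coprime (c - d) c" if "coprime c d"
        using that admissible_shift_a[of "- d" 1 c] by (simp add: admissible_def int_N coprime_commute)
      show "has_row (g \<otimes> inv x) c d" if "g \<in> carrier G" "has_row g (c - d) c" for g
        using has_row_mult_x(2)[OF that] by (simp add: int_N)
      show "has_row (g \<otimes> inv x) (- c) (- d)"
        if "g \<in> carrier G" "has_row g (- (c - d)) (- c)" for g
        using has_row_mult_x(2)[OF that] by (simp add: int_N)
    qed simp_all
  next
    case 7
    show ?thesis
    proof (rule step[where h = x])
      show "\<exists>g\<in>carrier G. cosets d (d - c) = stab #> g \<and>
          (admissible d (d - c) \<longrightarrow> has_row g d (d - c) \<or> has_row g (- d) (- (d - c)))"
        using "1.IH" 7 by simp
      show "cosets c d = cosets d (d - c) #> x"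
        using 7 by (subst cosets.simps) simp
      show "coprime d (d - c)" if "coprime c d"
        using that admissible_shift_a[of "- c" 1 d]
        by (simp add: admissible_def int_N coprime_commute)
      show "has_row (g \<otimes> x) c d" if "g \<in> carrier G" "has_row g d (d - c)" for g
        using has_row_mult_x(1)[OF that] by (simp add: int_N)
      show "has_row (g \<otimes> x) (- c) (- d)" if "g \<in> carrier G" "has_row g (- d) (- (d - c))" for g
        using has_row_mult_x(1)[OF that] by (simp add: int_N)
    qed simp_all
  qed
qed

section \<open>Equivariance in type A2\<close>

lemma cosets_mult [simp]:
  "g \<in> carrier G \<Longrightarrow> h \<in> carrier G \<Longrightarrow> (cosets c d #> g) #> h = cosets c d #> (g \<otimes> h)"
  "cosets c d #> \<one> = cosets c d"
  "g \<in> carrier G \<Longrightarrow> cosets c d #> (g \<otimes> z) = cosets c d #> g"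
  "cosets c d #> z = cosets c d"
proof -
  obtain g' where g': "g' \<in> carrier G" "cosets c d = stab #> g'"
    using cosets_row by blast
  show "g \<in> carrier G \<Longrightarrow> h \<in> carrier G \<Longrightarrow> (cosets c d #> g) #> h = cosets c d #> (g \<otimes> h)"
    using g' by (simp add: G.m_assoc)
  show "cosets c d #> \<one> = cosets c d" "cosets c d #> z = cosets c d"
    using g' by simp_all
  show "cosets c d #> (g \<otimes> z) = cosets c d #> g" if "g \<in> carrier G"
    using g' that stab_coset_z[of "g' \<otimes> g"] by (simp add: G.m_assoc)
qed

lemma cosets_neg: "cosets (- c) (- d) = cosets c d"
proof -
  consider "c < 0" | "c = 0" | "c > 0" by linarith
  then show ?thesis
    by cases (simp_all add: cosets.simps[of c d] cosets.simps[of "- c" "- d"]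
      cosets.simps[of 0 d] cosets.simps[of 0 "- d"])
qed

lemma cosets_base: "cosets 0 d = stab" "c > 0 \<Longrightarrow> cosets c 0 = stab #> x"
  "c > 0 \<Longrightarrow> cosets c c = stab #> inv x"
  by (subst cosets.simps, simp)+

lemma cosets_mult_x_x: "cosets c d #> (x \<otimes> x) = cosets c d #> inv x"
proof -
  have closed: "x \<in> carrier G" "inv x \<in> carrier G" "x \<otimes> x \<in> carrier G" by simp_all
  have "x \<otimes> x = inv x \<otimes> z" using inv_cancel(1)[OF closed(1) closed(3)] by (simp add: z_eq)
  then show ?thesis using cosets_mult(3)[OF closed(2)] by metis
qed

text \<open>The moves of \<open>x\<close> from negative slopes to slopes above 1, and from (0, 1) to
  negative slopes, are recursion steps. For the move from slopes above 1 to (0, 1), both sides are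
  compared with a vector of negative slope, using that \<open>x\<close> has order 3 on
  cosets.\<close>

lemma cosets_x:
  assumes "coprime c d" shows "cosets (c - d) c = cosets c d #> x"
proof -
  have pos: "cosets (c - d) c = cosets c d #> x" if "coprime c d" "c > 0" for c d
  proof -
    consider "d = 0" | "c = d" | "d < 0" | "c < d" | "d > 0" "d < c" by linarith
    then show ?thesis
    proof cases
      case 1
      then show ?thesis
        using cosets_mult_x_x[of 0 1] \<open>c > 0\<close> by (simp add: cosets_base)
    next
      case 2
      then show ?thesis using \<open>c > 0\<close> by (simp add: cosets_base stab_subset)
    next
      case 3
      then have "cosets (c - d) c = cosets c (c - (c - d)) #> x"
        using \<open>c > 0\<close> by (subst cosets.simps) simp
      then show ?thesis by simp
    next
      case 4
      then have "cosets c d = cosets (c - d) c #> inv x"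
        using \<open>c > 0\<close> by (subst cosets.simps) simp
      then show ?thesis by simp
    next
      case 5
      have "cosets c d = cosets d (d - c) #> x"
        using 5 by (subst cosets.simps) simp
      moreover have "cosets (c - d) c = cosets (c - d - c) (c - d) #> inv x"
        using 5 by (subst cosets.simps) simp
      moreover have "cosets (c - d - c) (c - d) = cosets d (d - c)"
        using cosets_neg[of d "d - c"] by simp
      ultimately show ?thesis using cosets_mult_x_x by simp
    qed
  qed
  consider "c > 0" | "c < 0" | "c = 0" by linarith
  then show ?thesis
  proof cases
    case 2
    then have "cosets (- c - - d) (- c) = cosets (- c) (- d) #> x"
      using assms by (intro pos) simp_all
    then show ?thesis using cosets_neg[of "c - d" c] by (simp add: cosets_neg)
  next
    case 3
    then have "d = 1 \<or> d = - 1" using assms by auto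
    then have "cosets (- d) 0 = stab #> x"
      using cosets_neg[of 1 0] cosets_base(2)[of 1] by auto
    then show ?thesis using 3 by (simp add: cosets_base)
  qed (use assms pos in blast)
qed

text \<open>For negative slopes this is the recursion; for positive ones \<open>y\<close> and
  \<open>y^(-1)\<close> multiply cosets alike, as \<open>y^2 = z\<close>. At slopes infinity and 0
  it rests on \<open>x y = b^(-1) z\<close> and \<open>y = b x\<close>.\<close>

lemma cosets_y:
  assumes "coprime c d" shows "cosets (- d) c = cosets c d #> y"
proof -
  have pos: "cosets (- d) c = cosets c d #> y" if "coprime c d" "c > 0" for c d
  proof -
    consider "d = 0" | "d < 0" | "d > 0" by linarith
    then show ?thesis
    proof cases
      case 1
      have "stab #> (x \<otimes> y) = stab"
        using stab_coset_z[of "inv b"] stab_coset_inv_b[of \<one>] stab_subset unfolding x_y by simp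
      then show ?thesis using 1 \<open>c > 0\<close> by (simp add: cosets_base)
    next
      case 2
      then have "cosets c d = cosets (- d) c #> inv y"
        using \<open>c > 0\<close> by (subst cosets.simps) simp
      then show ?thesis by simp
    next
      case 3
      have "cosets d (- c) = cosets c d #> inv y"
        using 3 \<open>c > 0\<close> by (subst cosets.simps) simp
      moreover have "cosets (- d) c = cosets d (- c)"
        using cosets_neg[of d "- c"] by simp
      moreover have "cosets c d #> inv y = cosets c d #> y"
      proof -
        have "y = inv y \<otimes> z"
          using inv_cancel(1)[of y y] y_square by simp
        then show ?thesis using cosets_mult(3)[of "inv y" c d] by simp
      qed
      ultimately show ?thesis by simp
    qed
  qed
  consider "c > 0" | "c < 0" | "c = 0" by linarith
  then show ?thesis
  proof cases
    case 2
    then have "cosets (- (- d)) (- c) = cosets (- c) (- d) #> y"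
      using assms by (intro pos) simp_all
    then show ?thesis using cosets_neg[of "- d" c] by (simp add: cosets_neg)
  next
    case 3
    then have "cosets (- d) c = cosets c d #> x" using cosets_x[OF assms] by simp
    moreover have "stab #> y = stab #> x" unfolding y_eq by simp
    ultimately show ?thesis using 3 by (simp add: cosets_base)
  qed (use assms pos in blast)
qed

sublocale coset_section G \<rho> a b N m cosets
proof
  show "cosets 0 1 = stab" by (simp add: cosets_base)
next
  fix c d assume "admissible c d"
  then have "coprime c d" by (simp add: admissible_def)
  then have *: "coprime d (d - c)" "coprime c (d + c)"
    using admissible_shift_a[of "- c" 1 d] admissible_shift_a[of d 1 c]
    by (simp_all add: admissible_def int_N coprime_commute)
  \<comment> \<open>Since \<open>a = x^(-1) y\<close>, the vector (c, d) is pulled back by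
    \<open>x\<close> and then moved by \<open>y\<close>; the formula for \<open>b\<close> comes from
    \<open>b x = y\<close>.\<close>
  have "cosets c d = cosets d (d - c) #> x"
    using cosets_x[OF *(1)] by simp
  moreover have "cosets (c - d) d = cosets d (d - c) #> y"
    using cosets_y[OF *(1)] by simp
  ultimately show "cosets (c - d) d = cosets c d #> a" by simp
  have "cosets c (d + c) #> x = cosets c d #> y"
    using cosets_x[OF *(2)] cosets_y[OF \<open>coprime c d\<close>] by simp
  then have "(cosets c (d + c) #> x) #> inv x = (cosets c d #> (b \<otimes> x)) #> inv x"
    by (simp only: y_eq)
  then show "cosets c (d + int N * c) = cosets c d #> b"
    by (simp add: int_N G.m_assoc)
qed (use cosets_row in blast)

end

section \<open>The groups \<open>G\<^sub>p\<close>\<close>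

lemma word_class_Cons:
  "word_class R (l # u) = word_class R [l] \<otimes>\<^bsub>presented_group R\<^esub> word_class R u"
  by simp

lemma word_class_inverse_letter:
  "word_class R [(x, False)] = inv\<^bsub>presented_group R\<^esub> word_class R [(x, True)]"
proof -
  interpret group "presented_group R" by (rule group_presented_group)
  have "word_class R [(x, False)] \<otimes>\<^bsub>presented_group R\<^esub> word_class R [(x, True)]
      = \<one>\<^bsub>presented_group R\<^esub>"
    using word_eq.cancel[of R x False] by (simp add: word_class_eq_iff)
  then show ?thesis
    using inv_equality[of "word_class R [(x, False)]" "word_class R [(x, True)]"] by simp
qed

lemma presented_group_generate:
  "carrier (presented_group R)
    = generate (presented_group R) (range (\<lambda>x. word_class R [(x, True)]))"
    (is "_ = generate _ ?S")
proof
  interpret group "presented_group R" by (rule group_presented_group)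
  show "generate (presented_group R) ?S \<subseteq> carrier (presented_group R)"
    by (rule generate_incl) auto
  have letter: "word_class R [l] \<in> generate (presented_group R) ?S" for l
    by (cases l; cases "snd l") (auto simp: word_class_inverse_letter intro: generate.intros)
  have "word_class R u \<in> generate (presented_group R) ?S" for u
  proof (induction u)
    case Nil
    then show ?case using generate.one[of "presented_group R"] by simp
  next
    case (Cons l u)
    then show ?case by (subst word_class_Cons) (intro generate.eng letter)
  qed
  then show "carrier (presented_group R) \<subseteq> generate (presented_group R) ?S" by auto
qed

lemma group_artin_group: "group (artin_group p)"
  by (simp add: artin_group_def group_presented_group)

lemma artin_gens_closed [simp]:
  "artin_a p \<in> carrier (artin_group p)" "artin_b p \<in> carrier (artin_group p)"
  by (simp_all add: artin_a_def artin_b_def artin_group_def)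

lemma artin_group_generate:
  "carrier (artin_group p) = generate (artin_group p) {artin_a p, artin_b p}"
proof -
  have UNIV: "UNIV = {Gen_a, Gen_b}" by (auto intro: artin_gen.exhaust)
  have "range f = {f Gen_a, f Gen_b}" for f :: "artin_gen \<Rightarrow> artin_gen word set"
    unfolding UNIV by simp
  then show ?thesis
    unfolding artin_group_def artin_a_def artin_b_def presented_group_generate by simp
qed

lemma positive_word_class:
  "word_class (artin_relations p) (positive_word (Gen_a # xs))
    = artin_a p \<otimes>\<^bsub>artin_group p\<^esub> word_class (artin_relations p) (positive_word xs)"
  "word_class (artin_relations p) (positive_word (Gen_b # xs))
    = artin_b p \<otimes>\<^bsub>artin_group p\<^esub> word_class (artin_relations p) (positive_word xs)"
  "word_class (artin_relations p) (positive_word []) = \<one>\<^bsub>artin_group p\<^esub>"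
  by (simp_all add: positive_word_def artin_a_def artin_b_def artin_group_def)

section \<open>The element Delta and central powers of \<open>a b\<close>\<close>

lemma alternating_numeral:
  "alternating 3 u v = [u, v, u]" "alternating 4 u v = [u, v, u, v]"
  "alternating 6 u v = [u, v, u, v, u, v]"
  by (simp_all add: numeral_eq_Suc)

lemma alternating_even: "alternating (2 * k) u v = concat (replicate k [u, v])"
  by (induction k) simp_all

lemma artin_Delta_3:
  "artin_Delta 3 = artin_a 3 \<otimes>\<^bsub>artin_group 3\<^esub> artin_b 3 \<otimes>\<^bsub>artin_group 3\<^esub> artin_a 3"
  "artin_Delta 3 = artin_b 3 \<otimes>\<^bsub>artin_group 3\<^esub> artin_a 3 \<otimes>\<^bsub>artin_group 3\<^esub> artin_b 3"
proof -
  interpret group "artin_group 3" by (rule group_artin_group)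
  show "artin_Delta 3 = artin_a 3 \<otimes>\<^bsub>artin_group 3\<^esub> artin_b 3 \<otimes>\<^bsub>artin_group 3\<^esub> artin_a 3"
    by (simp add: artin_Delta_def alternating_numeral positive_word_class m_assoc)
  show "artin_Delta 3 = artin_b 3 \<otimes>\<^bsub>artin_group 3\<^esub> artin_a 3 \<otimes>\<^bsub>artin_group 3\<^esub> artin_b 3"
    by (simp add: artin_Delta_alt alternating_numeral positive_word_class m_assoc)
qed

lemma (in group) pow_mult_rotate:
  assumes "a \<in> carrier G" "b \<in> carrier G"
  shows "a \<otimes> (b \<otimes> a) [^] (k :: nat) = (a \<otimes> b) [^] k \<otimes> a"
  using assms by (induction k) (simp_all add: m_assoc, simp_all flip: m_assoc)

context
  fixes k :: nat
begin

abbreviation (input) G_even where "G_even \<equiv> artin_group (2 * k)"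
abbreviation (input) a_even where "a_even \<equiv> artin_a (2 * k)"
abbreviation (input) b_even where "b_even \<equiv> artin_b (2 * k)"

interpretation group G_even by (rule group_artin_group)

lemma artin_Delta_even:
  "artin_Delta (2 * k) = (a_even \<otimes>\<^bsub>G_even\<^esub> b_even) [^]\<^bsub>G_even\<^esub> k"
  "artin_Delta (2 * k) = (b_even \<otimes>\<^bsub>G_even\<^esub> a_even) [^]\<^bsub>G_even\<^esub> k"
proof -
  have pow_commute: "u [^]\<^bsub>G_even\<^esub> j \<otimes>\<^bsub>G_even\<^esub> u = u \<otimes>\<^bsub>G_even\<^esub> u [^]\<^bsub>G_even\<^esub> j"
    if "u \<in> carrier G_even" for u and j :: nat
    using that by (metis nat_pow_Suc nat_pow_Suc2)
  have *: "word_class (artin_relations (2 * k)) (positive_word (concat (replicate j [Gen_a, Gen_b])))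
      = (a_even \<otimes>\<^bsub>G_even\<^esub> b_even) [^]\<^bsub>G_even\<^esub> j"
    "word_class (artin_relations (2 * k)) (positive_word (concat (replicate j [Gen_b, Gen_a])))
      = (b_even \<otimes>\<^bsub>G_even\<^esub> a_even) [^]\<^bsub>G_even\<^esub> j"
    for j
    by (induction j) (simp_all add: positive_word_class pow_commute m_assoc)
  show "artin_Delta (2 * k) = (a_even \<otimes>\<^bsub>G_even\<^esub> b_even) [^]\<^bsub>G_even\<^esub> k"
    using *(1)[of k] by (simp add: artin_Delta_def alternating_even)
  show "artin_Delta (2 * k) = (b_even \<otimes>\<^bsub>G_even\<^esub> a_even) [^]\<^bsub>G_even\<^esub> k"
    using *(2)[of k] by (simp add: artin_Delta_alt alternating_even)
qed

text \<open>Moving \<open>a\<close> through \<open>(b a)^k\<close> gives \<open>(a b)^k a\<close>,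
  and the two powers agree, being the two sides of the defining relation; likewise for
  \<open>b\<close>.\<close>

lemma artin_even_power_central:
  assumes "g \<in> carrier G_even"
  shows "g \<otimes>\<^bsub>G_even\<^esub> (a_even \<otimes>\<^bsub>G_even\<^esub> b_even) [^]\<^bsub>G_even\<^esub> k
    = (a_even \<otimes>\<^bsub>G_even\<^esub> b_even) [^]\<^bsub>G_even\<^esub> k \<otimes>\<^bsub>G_even\<^esub> g"
proof (rule commute_generate)
  show "g \<in> generate G_even {a_even, b_even}"
    using assms by (simp flip: artin_group_generate)
  fix s assume "s \<in> {a_even, b_even}"
  then consider "s = a_even" | "s = b_even" by blast
  then show "s \<otimes>\<^bsub>G_even\<^esub> (a_even \<otimes>\<^bsub>G_even\<^esub> b_even) [^]\<^bsub>G_even\<^esub> k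
      = (a_even \<otimes>\<^bsub>G_even\<^esub> b_even) [^]\<^bsub>G_even\<^esub> k \<otimes>\<^bsub>G_even\<^esub> s"
    using pow_mult_rotate[of a_even b_even k] pow_mult_rotate[of b_even a_even k] artin_Delta_even
    by cases auto
qed auto

end

text \<open>With D = a b a = b a b one has a D = D b and b D = D a, so D^2 commutes with both
  generators; and D^2 = (a b a) (b a b) = (a b)^3.\<close>

lemma (in group) braid_cube_central:
  assumes "a \<in> carrier G" "b \<in> carrier G" "a \<otimes> b \<otimes> a = b \<otimes> a \<otimes> b" "g \<in> generate G {a, b}"
  shows "g \<otimes> (a \<otimes> b) [^] (3 :: nat) = (a \<otimes> b) [^] (3 :: nat) \<otimes> g"
proof (rule commute_generate[OF assms(4)])
  let ?y = "a \<otimes> b \<otimes> a"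
  have cube: "(a \<otimes> b) [^] (3 :: nat) = ?y \<otimes> ?y"
  proof -
    have "?y \<otimes> ?y = ?y \<otimes> (b \<otimes> a \<otimes> b)" by (rule arg_cong[OF assms(3)])
    also have "\<dots> = (a \<otimes> b) [^] (3 :: nat)"
      using assms(1,2) by (simp add: numeral_eq_Suc m_assoc)
    finally show ?thesis ..
  qed
  have "?y \<otimes> a = b \<otimes> a \<otimes> b \<otimes> a" by (simp only: assms(3))
  also have "\<dots> = b \<otimes> ?y" using assms(1,2) by (simp add: m_assoc)
  finally have ya: "?y \<otimes> a = b \<otimes> ?y" .
  have "a \<otimes> ?y = a \<otimes> (b \<otimes> a \<otimes> b)" by (simp only: assms(3))
  also have "\<dots> = ?y \<otimes> b" using assms(1,2) by (simp add: m_assoc)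
  finally have ay: "a \<otimes> ?y = ?y \<otimes> b" .
  fix s assume "s \<in> {a, b}"
  then consider "s = a" | "s = b" by blast
  then have "s \<otimes> (?y \<otimes> ?y) = ?y \<otimes> ?y \<otimes> s"
  proof cases
    case 1
    have "a \<otimes> (?y \<otimes> ?y) = (a \<otimes> ?y) \<otimes> ?y" using assms(1,2) by (simp add: m_assoc)
    also have "\<dots> = ?y \<otimes> (b \<otimes> ?y)" unfolding ay using assms(1,2) by (simp add: m_assoc)
    also have "\<dots> = ?y \<otimes> ?y \<otimes> a" unfolding ya[symmetric] using assms(1,2) by (simp add: m_assoc)
    finally show ?thesis using 1 by simp
  next
    case 2
    have "b \<otimes> (?y \<otimes> ?y) = (b \<otimes> ?y) \<otimes> ?y" using assms(1,2) by (simp add: m_assoc)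
    also have "\<dots> = ?y \<otimes> (a \<otimes> ?y)" unfolding ya[symmetric] using assms(1,2) by (simp add: m_assoc)
    also have "\<dots> = ?y \<otimes> ?y \<otimes> b" unfolding ay using assms(1,2) by (simp add: m_assoc)
    finally show ?thesis using 2 by simp
  qed
  then show "s \<otimes> (a \<otimes> b) [^] (3 :: nat) = (a \<otimes> b) [^] (3 :: nat) \<otimes> s"
    unfolding cube .
qed (use assms in auto)

text \<open>Both sides of the relation are positive words of length p, so sending every generator to
  1 respects it.\<close>

lemma artin_length_hom:
  obtains len where "len \<in> hom (artin_group p) integer_group"
    "len (artin_a p) = 1" "len (artin_b p) = 1"
proof -
  have eval: "eval_word integer_group (\<lambda>_. 1) (positive_word xs) = int (length xs)"
    for xs :: "artin_gen list"
    by (induction xs) (simp_all add: positive_word_def)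
  have "length (alternating n u v) = n" for n and u v :: artin_gen
    by (induction n arbitrary: u v) simp_all
  then have "\<exists>h\<in>hom (artin_group p) integer_group.
      \<forall>g. h (word_class (artin_relations p) [(g, True)]) = 1"
    unfolding artin_group_def
    by (intro presented_group_hom_exists) (auto simp: artin_relations_def eval)
  then show thesis using that by (auto simp: artin_a_def artin_b_def)
qed

text \<open>The length of the power is 2 k i, which already separates the exponents.\<close>

lemma artin_ab_pow_inject:
  assumes "k > 0"
  shows "inj (\<lambda>i :: int. ((artin_a p \<otimes>\<^bsub>artin_group p\<^esub> artin_b p) [^]\<^bsub>artin_group p\<^esub> (k :: nat)) [^]\<^bsub>artin_group p\<^esub> i)"
proof (rule injI)
  interpret group "artin_group p" by (rule group_artin_group)
  let ?t = "(artin_a p \<otimes>\<^bsub>artin_group p\<^esub> artin_b p) [^]\<^bsub>artin_group p\<^esub> k"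
  obtain len where len: "len \<in> hom (artin_group p) integer_group"
    "len (artin_a p) = 1" "len (artin_b p) = 1"
    by (rule artin_length_hom)
  interpret len: group_hom "artin_group p" integer_group len
    by (simp add: group_hom.intro group_hom_axioms.intro group_artin_group len(1))
  have "len ?t = int k * 2" by (simp add: len.hom_nat_pow len)
  then have eq: "len (?t [^]\<^bsub>artin_group p\<^esub> i) = i * (int k * 2)" for i :: int
    by (simp only: len.hom_int_pow nat_pow_closed m_closed artin_gens_closed
        group_int_pow_integer_group)
  fix i j :: int
  assume ij: "?t [^]\<^bsub>artin_group p\<^esub> i = ?t [^]\<^bsub>artin_group p\<^esub> j"
  have "i * (int k * 2) = j * (int k * 2)"
    using arg_cong[OF ij, of len] unfolding eq .
  then show "i = j" using assms by simp
qed

section \<open>The representation for p = 3, 4, 6\<close>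

lemma is_rho_exists:
  assumes "p \<in> {3, 4, 6}" shows "\<exists>\<rho>. is_rho p \<rho>"
proof -
  define f where "f g = (case g of Gen_a \<Rightarrow> mat2 1 0 (- int (p div 2)) 1 | Gen_b \<Rightarrow> mat2 1 1 0 1)" for g
  have closed: "f g \<in> carrier SL2Z" for g by (cases g) (simp_all add: f_def)
  have "eval_word SL2Z f (positive_word (alternating p Gen_a Gen_b))
      = eval_word SL2Z f (positive_word (alternating p Gen_b Gen_a))"
    using assms by (auto simp: positive_word_def f_def mat2_mult alternating_numeral)
  then have "\<exists>h\<in>hom (artin_group p) SL2Z. \<forall>g. h (word_class (artin_relations p) [(g, True)]) = f g"
    unfolding artin_group_def
    by (intro presented_group_hom_exists group_SL2Z closed) (auto simp: artin_relations_def)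
  then show ?thesis by (auto simp: is_rho_def artin_a_def artin_b_def f_def)
qed

lemma is_rho_image_kernel:
  assumes p: "p \<in> {3, 4, 6}" and \<rho>: "is_rho p \<rho>"
  defines "u \<equiv> (artin_a p \<otimes>\<^bsub>artin_group p\<^esub> artin_b p) [^]\<^bsub>artin_group p\<^esub>
      (if p = 3 then 6 else if p = 4 then 4 else 3 :: nat)"
  shows "\<rho> ` carrier (artin_group p) = Gamma1 (p div 2) \<and>
    kernel (artin_group p) SL2Z \<rho> = generate (artin_group p) {u} \<and>
    (\<forall>g\<in>carrier (artin_group p). \<forall>i :: int.
      g \<otimes>\<^bsub>artin_group p\<^esub> u [^]\<^bsub>artin_group p\<^esub> i = u [^]\<^bsub>artin_group p\<^esub> i \<otimes>\<^bsub>artin_group p\<^esub> g)"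
proof -
  have monodromy: "artin_monodromy (artin_group p) \<rho> (artin_a p) (artin_b p) (p div 2) m"
    if "p div 2 = 1 \<and> m = 3 \<or> p div 2 = 2 \<and> m = 2 \<or> p div 2 = 3 \<and> m = 3"
      and "\<And>g. g \<in> carrier (artin_group p) \<Longrightarrow>
        g \<otimes>\<^bsub>artin_group p\<^esub> (artin_a p \<otimes>\<^bsub>artin_group p\<^esub> artin_b p) [^]\<^bsub>artin_group p\<^esub> m
        = (artin_a p \<otimes>\<^bsub>artin_group p\<^esub> artin_b p) [^]\<^bsub>artin_group p\<^esub> m \<otimes>\<^bsub>artin_group p\<^esub> g"
    for m
  proof (intro artin_monodromy.intro artin_monodromy_axioms.intro)
    show "group_hom (artin_group p) SL2Z \<rho>"
      using \<rho> by (simp add: group_hom.intro group_hom_axioms.intro group_artin_group group_SL2Z is_rho_def)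
    show "p div 2 = 1 \<and> m = 3 \<or> p div 2 = 2 \<and> m = 2 \<or> p div 2 = 3 \<and> m = 3"
      by (rule that(1))
    show "carrier (artin_group p) = generate (artin_group p) {artin_a p, artin_b p}"
      by (rule artin_group_generate)
  qed (use that(2) \<rho> in \<open>simp_all add: is_rho_def\<close>)
  consider "p = 3" | "p = 4" | "p = 6" using p by blast
  then show ?thesis
  proof cases
    case 1
    interpret group "artin_group 3" by (rule group_artin_group)
    interpret artin_monodromy "artin_group 3" \<rho> "artin_a 3" "artin_b 3" 1 3
      using monodromy[of 3] braid_cube_central[of "artin_a 3" "artin_b 3"] artin_Delta_3 1
      by (simp flip: artin_group_generate)
    interpret artin_monodromy_braid "artin_group 3" \<rho> "artin_a 3" "artin_b 3" 1 3
      by unfold_locales (use artin_Delta_3 in simp_all)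
    show ?thesis
      using image_eq kernel_eq t_pow_commute unfolding 1 u_def t_def by simp
  next
    case 2
    interpret artin_monodromy "artin_group 4" \<rho> "artin_a 4" "artin_b 4" 2 2
      using monodromy[of 2] artin_even_power_central[of _ 2] 2 by simp
    interpret artin_monodromy_even "artin_group 4" \<rho> "artin_a 4" "artin_b 4" 2 2
      by unfold_locales simp
    show ?thesis
      using image_eq kernel_eq t_pow_commute unfolding 2 u_def t_def by simp
  next
    case 3
    interpret artin_monodromy "artin_group 6" \<rho> "artin_a 6" "artin_b 6" 3 3
      using monodromy[of 3] artin_even_power_central[of _ 3] 3 by simp
    interpret artin_monodromy_even "artin_group 6" \<rho> "artin_a 6" "artin_b 6" 3 3
      by unfold_locales simp
    show ?thesis
      using image_eq kernel_eq t_pow_commute unfolding 3 u_def t_def by simp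
  qed
qed

theorem fact9:
  fixes p N :: nat
  assumes "p \<in> {3, 4, 6}" and "N = p div 2"
  shows "(\<exists>\<rho>. is_rho p \<rho>) \<and>
    (\<forall>\<rho>. is_rho p \<rho> \<longrightarrow>
      (p = 3 \<longrightarrow> \<rho> (artin_Delta p) = mat2 0 1 (-1) 0) \<and>
      (p = 4 \<longrightarrow> \<rho> (artin_Delta p) = mat2 (-1) 0 0 (-1)) \<and>
      (p = 6 \<longrightarrow> \<rho> (artin_Delta p) = mat2 1 0 0 1) \<and>
      (p = 3 \<or> p = 4 \<longrightarrow> - mat 1 \<in> \<rho> ` carrier (artin_group p)) \<and>
      (p = 6 \<longrightarrow> - mat 1 \<notin> \<rho> ` carrier (artin_group p)) \<and>
      \<rho> ` carrier (artin_group p) = Gamma1 N \<and>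
      infinite (kernel (artin_group p) SL2Z \<rho>) \<and>
      cyclic_group ((artin_group p)\<lparr>carrier := kernel (artin_group p) SL2Z \<rho>\<rparr>) \<and>
      kernel (artin_group p) SL2Z \<rho> =
        generate (artin_group p)
          {(artin_a p \<otimes>\<^bsub>artin_group p\<^esub> artin_b p) [^]\<^bsub>artin_group p\<^esub>
             (if p = 3 then 6 else if p = 4 then 4 else 3 :: nat)} \<and>
      (\<exists>\<iota>. central_extension integer_group (artin_group p) (SL2Z\<lparr>carrier := Gamma1 N\<rparr>) \<iota> \<rho>))"
proof (intro conjI allI impI)
  show "\<exists>\<rho>. is_rho p \<rho>" using assms(1) by (rule is_rho_exists)
next
  fix \<rho> assume \<rho>: "is_rho p \<rho>"
  define k :: nat where "k = (if p = 3 then 6 else if p = 4 then 4 else 3)"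
  define u where "u = (artin_a p \<otimes>\<^bsub>artin_group p\<^esub> artin_b p) [^]\<^bsub>artin_group p\<^esub> k"
  interpret group_hom "artin_group p" SL2Z \<rho>
    using \<rho> by (simp add: group_hom.intro group_hom_axioms.intro group_artin_group group_SL2Z is_rho_def)
  have gens: "\<rho> (artin_a p) = mat2 1 0 (- int N) 1" "\<rho> (artin_b p) = mat2 1 1 0 1"
    using \<rho> assms(2) by (simp_all add: is_rho_def)
  have u [simp]: "u \<in> carrier (artin_group p)" by (simp add: u_def)
  note facts = is_rho_image_kernel[OF assms(1) \<rho>, folded k_def assms(2), folded u_def]
  from facts have image: "\<rho> ` carrier (artin_group p) = Gamma1 N"
    and kernel_generate: "kernel (artin_group p) SL2Z \<rho> = generate (artin_group p) {u}"
    by blast+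
  from facts have central: "u [^]\<^bsub>artin_group p\<^esub> i \<otimes>\<^bsub>artin_group p\<^esub> g
      = g \<otimes>\<^bsub>artin_group p\<^esub> u [^]\<^bsub>artin_group p\<^esub> i"
    if "g \<in> carrier (artin_group p)" for g and i :: int
    using that by simp
  have kernel: "kernel (artin_group p) SL2Z \<rho> = range (\<lambda>i :: int. u [^]\<^bsub>artin_group p\<^esub> i)"
    unfolding kernel_generate by (auto simp: G.generate_pow)
  have inj: "inj (\<lambda>i :: int. u [^]\<^bsub>artin_group p\<^esub> i)"
    unfolding u_def k_def by (rule artin_ab_pow_inject) simp
  \<comment> \<open>Given the image, this holds because -1 is congruent to 1 modulo N only if N
    divides 2.\<close>
  have minus_one: "- mat 1 \<in> \<rho> ` carrier (artin_group p) \<longleftrightarrow> N = 1 \<or> N = 2"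
    using assms unfolding image Gamma1_def
    by (auto simp: mat_1_eq_mat2 uminus_mat2 cong_iff_dvd_diff)
  let ?a = "artin_a p" and ?b = "artin_b p"
  have images: "\<rho> (?a \<otimes>\<^bsub>artin_group p\<^esub> ?b \<otimes>\<^bsub>artin_group p\<^esub> ?a)
      = mat2 1 0 (- int N) 1 ** mat2 1 1 0 1 ** mat2 1 0 (- int N) 1"
    "\<rho> ((?a \<otimes>\<^bsub>artin_group p\<^esub> ?b) [^]\<^bsub>artin_group p\<^esub> (2 :: nat))
      = mat2 1 1 (- int N) (1 - int N) ** mat2 1 1 (- int N) (1 - int N)"
    "\<rho> ((?a \<otimes>\<^bsub>artin_group p\<^esub> ?b) [^]\<^bsub>artin_group p\<^esub> (3 :: nat))
      = mat2 1 1 (- int N) (1 - int N) ** mat2 1 1 (- int N) (1 - int N)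
        ** mat2 1 1 (- int N) (1 - int N)"
    by (simp_all add: numeral_eq_Suc gens mat2_mult)
  show "\<rho> (artin_Delta p) = mat2 0 1 (-1) 0" if "p = 3"
    using images(1) artin_Delta_3(1) assms(2) that by (simp add: mat2_mult)
  show "\<rho> (artin_Delta p) = mat2 (-1) 0 0 (-1)" if "p = 4"
    using images(2) artin_Delta_even(1)[of 2] assms(2) that by (simp add: mat2_mult)
  show "\<rho> (artin_Delta p) = mat2 1 0 0 1" if "p = 6"
    using images(3) artin_Delta_even(1)[of 3] assms(2) that by (simp add: mat2_mult)
  show "- mat 1 \<in> \<rho> ` carrier (artin_group p)" if "p = 3 \<or> p = 4"
    using minus_one assms(2) that by auto
  show "- mat 1 \<notin> \<rho> ` carrier (artin_group p)" if "p = 6"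
    using minus_one assms(2) that by auto
  show "\<rho> ` carrier (artin_group p) = Gamma1 N" by (rule image)
  show "infinite (kernel (artin_group p) SL2Z \<rho>)"
    unfolding kernel using inj finite_imageD infinite_UNIV_int by blast
  show "kernel (artin_group p) SL2Z \<rho> =
        generate (artin_group p)
          {(artin_a p \<otimes>\<^bsub>artin_group p\<^esub> artin_b p) [^]\<^bsub>artin_group p\<^esub>
             (if p = 3 then 6 else if p = 4 then 4 else 3 :: nat)}"
    using kernel_generate unfolding u_def k_def .
  show "cyclic_group ((artin_group p)\<lparr>carrier := kernel (artin_group p) SL2Z \<rho>\<rparr>)"
  proof -
    let ?K = "(artin_group p)\<lparr>carrier := kernel (artin_group p) SL2Z \<rho>\<rparr>"
    have u_kernel: "u \<in> kernel (artin_group p) SL2Z \<rho>"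
      unfolding kernel_generate by (rule generate.incl) simp
    have "u [^]\<^bsub>?K\<^esub> i = u [^]\<^bsub>artin_group p\<^esub> i" for i :: int
      using G.int_pow_consistent[OF subgroup_kernel u_kernel] by simp
    then have "carrier ?K = range (\<lambda>i :: int. u [^]\<^bsub>?K\<^esub> i)"
      by (simp add: kernel)
    then show ?thesis
      using u_kernel group.cyclic_group[OF G.subgroup_imp_group[OF subgroup_kernel]] by auto
  qed
  show "\<exists>\<iota>. central_extension integer_group (artin_group p) (SL2Z\<lparr>carrier := Gamma1 N\<rparr>) \<iota> \<rho>"
  proof
    have "group (SL2Z\<lparr>carrier := Gamma1 N\<rparr>)"
      using H.subgroup_imp_group[OF img_is_subgroup] image by simp
    moreover have "(\<lambda>i :: int. u [^]\<^bsub>artin_group p\<^esub> i) \<in> mon integer_group (artin_group p)"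
      using inj by (auto simp: mon_def hom_def G.int_pow_mult)
    moreover have "\<rho> \<in> epi (artin_group p) (SL2Z\<lparr>carrier := Gamma1 N\<rparr>)"
      using image by (auto simp: epi_def hom_def)
    moreover have "kernel (artin_group p) (SL2Z\<lparr>carrier := Gamma1 N\<rparr>) \<rho> = kernel (artin_group p) SL2Z \<rho>"
      by (simp add: kernel_def)
    ultimately show "central_extension integer_group (artin_group p) (SL2Z\<lparr>carrier := Gamma1 N\<rparr>)
        (\<lambda>i :: int. u [^]\<^bsub>artin_group p\<^esub> i) \<rho>"
      unfolding central_extension_def short_exact_def
      using central group_artin_group by (auto simp: kernel)
  qed
qed

end
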